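(* For all integers $n \ge 1$ and $k \ge 0$, there is a bijection between the set of evil-avoiding permutations in $S_n$ with exactly $k$ recoils and the set of rectangular permutations in $S_n$ with exactly $k$ recoils.
   Context: A permutation $\pi\in S_n$ is written in one-line form $[\pi_1\,\pi_2\cdots\pi_n]$. It contains a pattern $\sigma\in S_m$ if some subsequence of $\pi$ of length $m$ has the same relative order as $\sigma$; otherwise it avoids $\sigma$. A permutation is evil-avoiding if it avoids $2413$, $4132$, $4213$ and $3214$. A permutation is rectangular if it avoids $2413$, $2431$, $4213$ and $4231$. A recoil of $\pi\in S_n$ is a value $i\in\{1,\dots,n-1\}$ such that $i+1$ occurs before $i$ in $\pi$ (equivalently, $\pi^{-1}_i>\pi^{-1}_{i+1}$). *)

theory Defs
  imports Main "HOL-Combinatorics.Multiset_Permutations"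
begin

(* Permutations of S_n are represented in one-line form as lists:
   permutations_of_set {1..n} = lists that are distinct and have set {1..n}. *)

definition contains_pattern :: "nat list \<Rightarrow> nat list \<Rightarrow> bool" where
  "contains_pattern \<pi> \<sigma> \<longleftrightarrow>
     (\<exists>ys. ys \<in> set (subseqs \<pi>) \<and> length ys = length \<sigma> \<and>
        (\<forall>i<length \<sigma>. \<forall>j<length \<sigma>. (ys ! i < ys ! j \<longleftrightarrow> \<sigma> ! i < \<sigma> ! j)))"

definition avoids :: "nat list \<Rightarrow> nat list \<Rightarrow> bool" where
  "avoids \<pi> \<sigma> \<longleftrightarrow> \<not> contains_pattern \<pi> \<sigma>"

definition evil_avoiding :: "nat list \<Rightarrow> bool" where
  "evil_avoiding \<pi> \<longleftrightarrow> avoids \<pi> [2,4,1,3] \<and> avoids \<pi> [4,1,3,2] \<and>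
                        avoids \<pi> [4,2,1,3] \<and> avoids \<pi> [3,2,1,4]"

definition rectangular :: "nat list \<Rightarrow> bool" where
  "rectangular \<pi> \<longleftrightarrow> avoids \<pi> [2,4,1,3] \<and> avoids \<pi> [2,4,3,1] \<and>
                     avoids \<pi> [4,2,1,3] \<and> avoids \<pi> [4,2,3,1]"

definition is_recoil :: "nat list \<Rightarrow> nat \<Rightarrow> bool" where
  "is_recoil \<pi> i \<longleftrightarrow> 1 \<le> i \<and> i < length \<pi> \<and>
     (\<exists>a b. a < b \<and> b < length \<pi> \<and> \<pi> ! a = i + 1 \<and> \<pi> ! b = i)"

definition recoils :: "nat list \<Rightarrow> nat set" where
  "recoils \<pi> = {i. is_recoil \<pi> i}"

end

theory Submission
  imports Defs "HOL-Library.Sublist"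
begin

text \<open>
  Let \<open>a(n,k)\<close> count the permutations of a class in \<open>S\<^sub>n\<close> with \<open>k\<close> recoils, and \<open>e(n,k)\<close> those
  of them that do not start with \<open>1\<close>. For both classes \<open>a(n+1,k) = a(n,k) + e(n+1,k)\<close> and
  \<open>e(n+2,k) = a(n+1,k-1) + 2 e(n+1,k)\<close>, so the counts agree.

  A rectangular permutation that does not start with \<open>1\<close> starts with \<open>a+1, a\<close> or with
  \<open>a, a+1\<close>, or has \<open>1\<close> in second place; deleting one of the first two entries gives the three terms.

  An evil-avoiding permutation \<open>P 1 Q\<close> with \<open>P\<close> nonempty has empty \<open>Q\<close> (delete \<open>1\<close>: the first term),
  or \<open>Q\<close> starts with \<open>2\<close> (delete \<open>1\<close>: the second), or \<open>Q\<close> starts with another value. In the last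
  case \<open>P\<close> is an increasing run of consecutive values. Shortening a run of length at least two,
  or deleting both \<open>P\<close> and \<open>1\<close> otherwise, shows that the number \<open>b(n,k)\<close> of such permutations satisfies
  \<open>b(n+3,k) = b(n+2,k) + a(n+1,k-1) + e(n+1,k)\<close>. The right-hand side is the three-case
  decomposition of \<open>e(n+2,k)\<close>, hence \<open>b(n+3,k) = e(n+2,k)\<close>.
\<close>

section \<open>Subsequences and patterns\<close>

lemma subseq_Cons_Cons_iff:
  "subseq (a # as) (x # xs) \<longleftrightarrow> a = x \<and> subseq as xs \<or> subseq (a # as) xs"
  using subseq_Cons' by auto

text \<open>An occurrence of a pattern either survives the deletion of the displayed
  \<open>m\<close> or splits at it. When an entry is inserted, only the second kind needs to be
  examined.\<close>

lemma subseq_insert_cases: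
  assumes "subseq ys (P @ m # Q)"
  obtains "subseq ys (P @ Q)"
  | us vs where "ys = us @ m # vs" "subseq us P" "subseq vs Q"
proof -
  obtain us vs where uv: "ys = us @ vs" "subseq us P" "subseq vs (m # Q)"
    using assms by (metis subseq_appendE)
  show thesis
  proof (cases vs)
    case Nil
    then show thesis using uv that(1) by (simp add: subseq_rev_drop_many)
  next
    case (Cons v vs')
    then have "v = m \<and> subseq vs' Q \<or> subseq vs Q"
      using uv(3) by (metis subseq_Cons_Cons_iff)
    then show thesis using uv Cons that by (auto intro: list_emb_append_mono)
  qed
qed

lemma subseq_map_conv: "subseq ys (map f xs) \<longleftrightarrow> (\<exists>zs. ys = map f zs \<and> subseq zs xs)"
proof
  assume "subseq ys (map f xs)"
  then show "\<exists>zs. ys = map f zs \<and> subseq zs xs"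
    by (metis nths_map subseq_conv_nths)
qed (auto intro: subseq_map)

lemma subseq_set: "subseq ys xs \<Longrightarrow> set ys \<subseteq> set xs"
  by (auto dest: list_emb_set)

lemma subseq_pair_asym:
  assumes "distinct xs" "subseq [a, b] xs"
  shows "\<not> subseq [b, a] xs"
  using assms
proof (induction xs)
  case (Cons x xs)
  show ?case
    using Cons.prems Cons.IH subseq_set[of "[a, b]" xs] subseq_set[of "[b, a]" xs]
    by (auto simp: subseq_Cons_Cons_iff subseq_singleton_left simp del: subseq_Cons2_iff)
qed simp

section \<open>Patterns of length four as chains of inequalities\<close>

lemma contains_pattern_subseq:
  assumes "subseq xs ys" "contains_pattern xs \<sigma>"
  shows "contains_pattern ys \<sigma>"
  using assms unfolding contains_pattern_def
  by (meson in_set_subseqs subseq_order.order_trans)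

lemma contains_pattern_map:
  assumes "strict_mono (f :: nat \<Rightarrow> nat)"
  shows "contains_pattern (map f xs) \<sigma> \<longleftrightarrow> contains_pattern xs \<sigma>"
proof -
  have eq: "(\<forall>i<length \<sigma>. \<forall>j<length \<sigma>. map f zs ! i < map f zs ! j \<longleftrightarrow> \<sigma> ! i < \<sigma> ! j) \<longleftrightarrow>
      (\<forall>i<length \<sigma>. \<forall>j<length \<sigma>. zs ! i < zs ! j \<longleftrightarrow> \<sigma> ! i < \<sigma> ! j)"
    if "length zs = length \<sigma>" for zs
    using that by (simp add: strict_mono_less[OF assms])
  have "contains_pattern (map f xs) \<sigma> \<longleftrightarrow>
      (\<exists>zs. subseq zs xs \<and> length zs = length \<sigma> \<and>
        (\<forall>i<length \<sigma>. \<forall>j<length \<sigma>. map f zs ! i < map f zs ! j \<longleftrightarrow> \<sigma> ! i < \<sigma> ! j))"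
    unfolding contains_pattern_def in_set_subseqs subseq_map_conv ex_simps[symmetric]
    by (subst ex_comm, rule ex_cong1) auto
  also have "\<dots> \<longleftrightarrow> contains_pattern xs \<sigma>"
    unfolding contains_pattern_def in_set_subseqs using eq by (intro ex_cong1 conj_cong refl)
  finally show ?thesis .
qed

lemma contains_pattern_4:
  "contains_pattern xs [p, q, r, s] \<longleftrightarrow>
     (\<exists>a b c d. subseq [a, b, c, d] xs \<and>
        (\<forall>i<4. \<forall>j<4. [a, b, c, d] ! i < [a, b, c, d] ! j \<longleftrightarrow> [p, q, r, s] ! i < [p, q, r, s] ! j))"
    (is "_ = (\<exists>a b c d. ?R a b c d)")
proof
  assume "contains_pattern xs [p, q, r, s]"
  then obtain ys where ys: "subseq ys xs" "length ys = 4"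
    "\<forall>i<4. \<forall>j<4. ys ! i < ys ! j \<longleftrightarrow> [p, q, r, s] ! i < [p, q, r, s] ! j"
    by (auto simp: contains_pattern_def numeral_eq_Suc)
  obtain a b c d where "ys = [a, b, c, d]"
    using ys(2) by (auto simp: length_Suc_conv numeral_eq_Suc)
  then have "?R a b c d" using ys by blast
  then show "\<exists>a b c d. ?R a b c d" by blast
next
  assume "\<exists>a b c d. ?R a b c d"
  then obtain a b c d where "?R a b c d" by blast
  then show "contains_pattern xs [p, q, r, s]"
    unfolding contains_pattern_def in_set_subseqs
    by (intro exI[of _ "[a, b, c, d]"]) (simp add: numeral_eq_Suc)
qed

text \<open>A pattern is a linear order on its four positions, so the sixteen comparisons collapse
  to the chain that lists \<open>a\<close>, \<open>b\<close>, \<open>c\<close>, \<open>d\<close> by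
  increasing value.\<close>

lemma contains_pattern_iffs:
  "contains_pattern xs [2,4,1,3] \<longleftrightarrow>
     (\<exists>a b c d. subseq [a, b, c, d] xs \<and> c < a \<and> a < d \<and> d < b)"
  "contains_pattern xs [4,1,3,2] \<longleftrightarrow>
     (\<exists>a b c d. subseq [a, b, c, d] xs \<and> b < d \<and> d < c \<and> c < a)"
  "contains_pattern xs [4,2,1,3] \<longleftrightarrow>
     (\<exists>a b c d. subseq [a, b, c, d] xs \<and> c < b \<and> b < d \<and> d < a)"
  "contains_pattern xs [3,2,1,4] \<longleftrightarrow>
     (\<exists>a b c d. subseq [a, b, c, d] xs \<and> c < b \<and> b < a \<and> a < d)"
  "contains_pattern xs [2,4,3,1] \<longleftrightarrow>
     (\<exists>a b c d. subseq [a, b, c, d] xs \<and> d < a \<and> a < c \<and> c < b)"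
  "contains_pattern xs [4,2,3,1] \<longleftrightarrow>
     (\<exists>a b c d. subseq [a, b, c, d] xs \<and> d < b \<and> b < c \<and> c < a)"
  unfolding contains_pattern_4
  by (intro ex_cong1 conj_cong refl; simp add: numeral_eq_Suc All_less_Suc2; safe?; linarith)+

lemma evil_avoiding_iff:
  "evil_avoiding xs \<longleftrightarrow> (\<forall>a b c d. subseq [a, b, c, d] xs \<longrightarrow>
     \<not> (c < a \<and> a < d \<and> d < b) \<and> \<not> (b < d \<and> d < c \<and> c < a) \<and>
     \<not> (c < b \<and> b < d \<and> d < a) \<and> \<not> (c < b \<and> b < a \<and> a < d))"
  unfolding evil_avoiding_def avoids_def contains_pattern_iffs by blast

lemma evil_avoidingD:
  assumes "evil_avoiding xs" "subseq [a, b, c, d] xs"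
  shows "\<not> (c < a \<and> a < d \<and> d < b)" "\<not> (b < d \<and> d < c \<and> c < a)"
    "\<not> (c < b \<and> b < d \<and> d < a)" "\<not> (c < b \<and> b < a \<and> a < d)"
  using assms unfolding evil_avoiding_iff by blast+

text \<open>The four patterns differ only by swapping the first two or the last two entries: the
  values 2 and 4 come first, 1 and 3 last. With \<open>min\<close> and \<open>max\<close> they
  become a single condition.\<close>

lemma rectangular_iff:
  "rectangular xs \<longleftrightarrow> (\<forall>a b c d. subseq [a, b, c, d] xs \<longrightarrow>
     \<not> (min c d < min a b \<and> min a b < max c d \<and> max c d < max a b))"
proof -
  have "min c d < min a b \<and> min a b < max c d \<and> max c d < max a b \<longleftrightarrow>
      c < a \<and> a < d \<and> d < b \<or> d < a \<and> a < c \<and> c < b \<or>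
      c < b \<and> b < d \<and> d < a \<or> d < b \<and> b < c \<and> c < a" for a b c d :: nat
    by linarith
  then show ?thesis
    unfolding rectangular_def avoids_def contains_pattern_iffs by (simp only:) blast
qed

lemma evil_avoiding_subseq: "subseq xs ys \<Longrightarrow> evil_avoiding ys \<Longrightarrow> evil_avoiding xs"
  and rectangular_subseq: "subseq xs ys \<Longrightarrow> rectangular ys \<Longrightarrow> rectangular xs"
  unfolding evil_avoiding_def rectangular_def avoids_def by (meson contains_pattern_subseq)+

lemma evil_avoiding_map: "strict_mono f \<Longrightarrow> evil_avoiding (map f xs) \<longleftrightarrow> evil_avoiding xs"
  and rectangular_map: "strict_mono f \<Longrightarrow> rectangular (map f xs) \<longleftrightarrow> rectangular xs"
  by (simp_all add: evil_avoiding_def rectangular_def avoids_def contains_pattern_map)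

section \<open>Recoils under insertion of an entry\<close>

definition Sn :: "nat \<Rightarrow> nat list set" where
  "Sn n = permutations_of_set {1..n}"

lemma Sn_iff: "\<pi> \<in> Sn n \<longleftrightarrow> set \<pi> = {1..n} \<and> distinct \<pi>"
  by (auto simp: Sn_def permutations_of_set_def)

lemma subseq_pair_iff_nth:
  "subseq [x, y] xs \<longleftrightarrow> (\<exists>a b. a < b \<and> b < length xs \<and> xs ! a = x \<and> xs ! b = y)"
proof (induction xs)
  case (Cons z zs)
  have "(\<exists>a b. a < b \<and> b < length (z # zs) \<and> (z # zs) ! a = x \<and> (z # zs) ! b = y) \<longleftrightarrow>
      x = z \<and> y \<in> set zs \<or> (\<exists>a b. a < b \<and> b < length zs \<and> zs ! a = x \<and> zs ! b = y)"
    (is "?L \<longleftrightarrow> ?R")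
  proof
    assume ?L
    then obtain a b where ab: "a < b" "b < length (z # zs)" "(z # zs) ! a = x" "(z # zs) ! b = y"
      by blast
    obtain b' where b: "b = Suc b'" using ab(1) by (cases b) auto
    show ?R
    proof (cases a)
      case 0
      then show ?R using ab b by (auto simp: in_set_conv_nth)
    next
      case (Suc a')
      then show ?R using ab b by auto
    qed
  next
    assume ?R
    then consider "x = z" "y \<in> set zs"
      | a b where "a < b" "b < length zs" "zs ! a = x" "zs ! b = y" by blast
    then show ?L
    proof cases
      case 1
      then obtain b where "b < length zs" "zs ! b = y" by (auto simp: in_set_conv_nth)
      with 1 show ?L by (intro exI[of _ 0] exI[of _ "Suc b"]) auto
    next
      case 2
      then show ?L by (intro exI[of _ "Suc a"] exI[of _ "Suc b"]) auto
    qed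
  qed
  then show ?case
    using Cons.IH by (simp only: subseq_Cons_Cons_iff subseq_singleton_left)
qed simp

text \<open>The bounds on \<open>i\<close> in \<open>is_recoil\<close> come for free, since
  \<open>i\<close> and \<open>Suc i\<close> are both entries of a permutation of
  \<open>{1..n}\<close>.\<close>

lemma recoils_eq:
  assumes "\<pi> \<in> Sn n"
  shows "recoils \<pi> = {i. subseq [Suc i, i] \<pi>}"
proof -
  have len: "length \<pi> = n"
    using assms distinct_card[of \<pi>] by (simp add: Sn_iff)
  have "1 \<le> i \<and> i < n" if "subseq [Suc i, i] \<pi>" for i
    using subseq_set[OF that] assms by (auto simp: Sn_iff)
  then show ?thesis
    by (auto simp: recoils_def is_recoil_def len subseq_pair_iff_nth)
qed

lemma finite_recoils: "finite (recoils \<pi>)"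
  by (rule finite_subset[of _ "{..<length \<pi>}"]) (auto simp: recoils_def is_recoil_def)

section \<open>Inserting a new least value\<close>

lemma insert_one_perm:
  assumes "map Suc \<tau> = P @ Q"
  shows "P @ 1 # Q \<in> Sn (Suc n) \<longleftrightarrow> \<tau> \<in> Sn n"
proof -
  have s: "set P \<union> set Q = Suc ` set \<tau>" and d: "distinct (P @ Q) \<longleftrightarrow> distinct \<tau>"
    using arg_cong[OF assms, of set] arg_cong[OF assms, of distinct] by (auto simp: distinct_map)
  have S: "{1..Suc n} = insert 1 (Suc ` {1..n})"
    by (simp only: image_Suc_atLeastAtMost) auto
  have "set (P @ 1 # Q) = {1..Suc n} \<longleftrightarrow> insert 1 (Suc ` set \<tau>) = insert 1 (Suc ` {1..n})"
    unfolding S using s by auto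
  moreover have "distinct (P @ 1 # Q) \<longleftrightarrow> 1 \<notin> Suc ` set \<tau> \<and> distinct \<tau>"
    using s d by auto
  ultimately have "P @ 1 # Q \<in> Sn (Suc n) \<longleftrightarrow>
      (insert 1 (Suc ` set \<tau>) = insert 1 (Suc ` {1..n})) \<and> 1 \<notin> Suc ` set \<tau> \<and> distinct \<tau>"
    by (simp only: Sn_iff)
  also have "\<dots> \<longleftrightarrow> (Suc ` set \<tau> = Suc ` {1..n}) \<and> 1 \<notin> Suc ` set \<tau> \<and> distinct \<tau>"
    using insert_ident[of 1 "Suc ` set \<tau>" "Suc ` {1..n}"] by auto
  also have "\<dots> \<longleftrightarrow> \<tau> \<in> Sn n"
    unfolding inj_image_eq_iff[OF inj_Suc] Sn_iff by auto
  finally show ?thesis .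
qed

lemma delete_one_perm:
  assumes "P @ 1 # Q \<in> Sn (Suc n)"
  obtains \<tau> where "\<tau> \<in> Sn n" "map Suc \<tau> = P @ Q"
proof -
  have "set (P @ 1 # Q) = {1..Suc n}"
    using assms by (simp only: Sn_iff)
  then have "1 \<le> x" if "x \<in> set (P @ Q)" for x
    using that by (metis Un_iff atLeastAtMost_iff list.set_intros(2) set_append)
  then have "\<forall>x \<in> set (P @ Q). Suc (x - 1) = x" by (metis Suc_diff_1 less_eq_Suc_le One_nat_def)
  then have "map Suc (map (\<lambda>x. x - 1) (P @ Q)) = P @ Q"
    by (simp add: map_idI)
  then show thesis using that insert_one_perm assms by blast
qed

text \<open>Recoils of \<tau> shift by one together with the values. The only consecutive values
  involving the new entry are 1 and 2, a recoil exactly when 2 lies to the left.\<close>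

lemma insert_one_recoils:
  assumes \<tau>: "\<tau> \<in> Sn n" and eq: "map Suc \<tau> = P @ Q"
  shows "card (recoils (P @ 1 # Q)) = card (recoils \<tau>) + (if 2 \<in> set P then 1 else 0)"
proof -
  have \<pi>: "P @ 1 # Q \<in> Sn (Suc n)" using insert_one_perm[OF eq] \<tau> by simp
  \<comment> \<open>No recoil is 0, so the possible new recoil 1 is not among the shifted ones and
    the cardinalities add.\<close>
  have no1: "1 \<notin> Suc ` recoils \<tau>"
    by (auto simp: recoils_def is_recoil_def)
  have "recoils (P @ 1 # Q) = Suc ` recoils \<tau> \<union> {i. i = 1 \<and> 2 \<in> set P}" (is "?L = ?R")
  proof (intro set_eqI iffI)
    fix i assume "i \<in> ?L"
    then have "subseq [Suc i, i] (P @ 1 # Q)" using recoils_eq[OF \<pi>] by simp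
    then show "i \<in> ?R"
    proof (cases rule: subseq_insert_cases)
      case 1
      then obtain zs where zs: "[Suc i, i] = map Suc zs" "subseq zs \<tau>"
        unfolding eq[symmetric] subseq_map_conv by metis
      then have "i = Suc (last zs)" "subseq [Suc (last zs), last zs] \<tau>" by auto
      then show ?thesis using recoils_eq[OF \<tau>] by blast
    next
      case (2 us vs)
      \<comment> \<open>This excludes the split in which the inserted 1 plays the role of
        \<open>Suc i\<close>, where \<open>i\<close> would be 0.\<close>
      have "0 \<notin> set Q" using \<pi> by (auto simp: Sn_iff)
      then show ?thesis using 2
        by (auto simp: Cons_eq_append_conv subseq_singleton_left numeral_2_eq_2)
    qed
  next
    fix i assume "i \<in> ?R"
    then consider j where "i = Suc j" "subseq [Suc j, j] \<tau>" | "i = 1" "2 \<in> set P"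
      using recoils_eq[OF \<tau>] by blast
    then have "subseq [Suc i, i] (P @ 1 # Q)"
    proof cases
      case 1
      then have "subseq [Suc i, i] (P @ Q)"
        unfolding eq[symmetric] subseq_map_conv by (intro exI[of _ "[Suc j, j]"]) auto
      moreover have "subseq (P @ Q) (P @ 1 # Q)" by (intro list_emb_append_mono) auto
      ultimately show ?thesis using subseq_order.order_trans by blast
    next
      case 2
      then show ?thesis
        using list_emb_append_mono[of "(=)" "[2]" P "[1]" "1 # Q"]
        by (simp add: subseq_singleton_left numeral_2_eq_2)
    qed
    then show "i \<in> ?L" using recoils_eq[OF \<pi>] by simp
  qed
  then show ?thesis
    using no1 finite_recoils[of \<tau>] by (auto simp: card_image)
qed

section \<open>Inserting a new first entry of any value\<close>

text \<open>The order embedding of the naturals that omits exactly \<open>v\<close>; thus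
  \<open>v # map (bump v) \<tau>\<close> is \<tau> with a new first entry of value
  \<open>v\<close>.\<close>

definition bump :: "nat \<Rightarrow> nat \<Rightarrow> nat" where
  "bump v x = (if x < v then x else Suc x)"

lemma strict_mono_bump: "strict_mono (bump v)"
  by (auto simp: strict_mono_def bump_def)

lemma inj_bump: "inj (bump v)"
  using strict_mono_bump strict_mono_on_imp_inj_on by blast

lemma bump_neq: "bump v x \<noteq> v"
  by (simp add: bump_def)

lemma bump_image:
  assumes "1 \<le> v" "v \<le> Suc n"
  shows "bump v ` {1..n} = {1..Suc n} - {v}"
proof (intro set_eqI iffI)
  fix x assume x: "x \<in> {1..Suc n} - {v}"
  then have "x = bump v (if x < v then x else x - 1)" "(if x < v then x else x - 1) \<in> {1..n}"
    using assms by (auto simp: bump_def)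
  then show "x \<in> bump v ` {1..n}" by blast
qed (auto simp: bump_def)

lemma bump_perm:
  assumes "1 \<le> v" "v \<le> Suc n"
  shows "v # map (bump v) \<tau> \<in> Sn (Suc n) \<longleftrightarrow> \<tau> \<in> Sn n"
proof -
  have "v \<notin> bump v ` set \<tau>" using bump_neq by (metis imageE)
  then have "v # map (bump v) \<tau> \<in> Sn (Suc n) \<longleftrightarrow> insert v (bump v ` set \<tau>) = {1..Suc n} \<and> distinct \<tau>"
    using inj_on_subset[OF inj_bump subset_UNIV] by (simp add: Sn_iff distinct_map)
  also have "insert v (bump v ` set \<tau>) = {1..Suc n} \<longleftrightarrow> bump v ` set \<tau> = {1..Suc n} - {v}"
    using \<open>v \<notin> bump v ` set \<tau>\<close> assms insert_Diff[of v "{1..Suc n}"]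
    by (metis Diff_insert_absorb atLeastAtMost_iff)
  also have "\<dots> \<longleftrightarrow> set \<tau> = {1..n}"
    unfolding bump_image[OF assms, symmetric] by (rule inj_image_eq_iff[OF inj_bump])
  finally show ?thesis by (simp only: Sn_iff)
qed

lemma unbump_perm:
  assumes "v # xs \<in> Sn (Suc n)"
  obtains \<tau> where "\<tau> \<in> Sn n" "xs = map (bump v) \<tau>"
proof -
  have v: "1 \<le> v" "v \<le> Suc n" and "\<forall>x \<in> set xs. x \<noteq> v"
    using assms by (auto simp: Sn_iff)
  then have "bump v (if x < v then x else x - 1) = x" if "x \<in> set xs" for x
    using that nat_neq_iff[of x v] by (auto simp: bump_def)
  then have "map (bump v) (map (\<lambda>x. if x < v then x else x - 1) xs) = xs"
    by (simp add: map_idI)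
  then show thesis using that assms bump_perm[OF v] by metis
qed

text \<open>Consecutive values stay consecutive under \<open>bump v\<close>, except
  \<open>v - 1\<close> and \<open>v\<close>, which the new value separates. The new entry stands
  first and so forms a recoil with \<open>v - 1\<close> whenever that value occurs.\<close>

lemma bump_recoils:
  assumes \<tau>: "\<tau> \<in> Sn n" and v: "1 \<le> v" "v \<le> Suc n"
  shows "recoils (v # map (bump v) \<tau>) = bump v ` recoils \<tau> \<union> {i. Suc i = v \<and> i \<in> set \<tau>}"
    (is "?L = ?R")
proof (intro set_eqI iffI)
  have \<pi>: "v # map (bump v) \<tau> \<in> Sn (Suc n)" using bump_perm[OF v] \<tau> by simp
  note R = recoils_eq[OF \<pi>] recoils_eq[OF \<tau>]
  {
    fix i assume "i \<in> ?L"
    then have "subseq [Suc i, i] (v # map (bump v) \<tau>)" using R by simp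
    then consider "Suc i = v" "i \<in> bump v ` set \<tau>" | "subseq [Suc i, i] (map (bump v) \<tau>)"
      by (auto simp: subseq_Cons_Cons_iff subseq_singleton_left simp del: subseq_Cons2_iff)
    then show "i \<in> ?R"
    proof cases
      case 1
      then show ?thesis by (auto simp: bump_def)
    next
      case 2
      then obtain zs where "[Suc i, i] = map (bump v) zs" "subseq zs \<tau>"
        unfolding subseq_map_conv by metis
      then obtain x y where xy: "bump v x = Suc i" "bump v y = i" "subseq [x, y] \<tau>"
        by (auto simp: Cons_eq_map_conv)
      then have "x = Suc y" by (auto simp: bump_def split: if_splits)
      then show ?thesis using xy R by blast
    qed
  }
  {
    fix i assume "i \<in> ?R"
    \<comment> \<open>If \<open>Suc j = v\<close>, then \<open>bump v j = j\<close> and the recoil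
      is witnessed by the new first entry, so it falls under the second case.\<close>
    then consider j where "i = bump v j" "subseq [Suc j, j] \<tau>" "Suc j \<noteq> v"
      | "Suc i = v" "i \<in> set \<tau>"
      using R subseq_set by (fastforce simp: bump_def)
    then have "subseq [Suc i, i] (v # map (bump v) \<tau>)"
    proof cases
      case 1
      then have "subseq [Suc i, i] (map (bump v) \<tau>)"
        unfolding subseq_map_conv by (intro exI[of _ "[Suc j, j]"]) (auto simp: bump_def)
      then show ?thesis by (rule list_emb_Cons)
    next
      case 2
      then have "i \<in> bump v ` set \<tau>" by (force simp: bump_def)
      then show ?thesis using 2 by (simp add: subseq_singleton_left)
    qed
    then show "i \<in> ?L" using R by simp
  }
qed

text \<open>The recoil that the new entry forms with \<open>v - 1\<close> replaces the one formed by
  \<open>v\<close> and \<open>v - 1\<close> in \<tau>, so none is gained.\<close>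

lemma bump_recoils_same:
  assumes "\<tau> \<in> Sn n" "1 \<le> v" "v \<le> Suc n" "v \<noteq> 1 \<Longrightarrow> subseq [v, v - 1] \<tau>"
  shows "card (recoils (v # map (bump v) \<tau>)) = card (recoils \<tau>)"
proof -
  have "{i. Suc i = v \<and> i \<in> set \<tau>} \<subseteq> bump v ` recoils \<tau>"
  proof
    fix i assume i: "i \<in> {i. Suc i = v \<and> i \<in> set \<tau>}"
    then have "v \<noteq> 1" using assms(1) by (auto simp: Sn_iff)
    then have "subseq [Suc i, i] \<tau>" using i assms(4) by auto
    then have "i \<in> recoils \<tau>" using recoils_eq[OF assms(1)] by simp
    moreover have "i = bump v i" using i by (auto simp: bump_def)
    ultimately show "i \<in> bump v ` recoils \<tau>" by (rule rev_image_eqI)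
  qed
  then have "recoils (v # map (bump v) \<tau>) = bump v ` recoils \<tau>"
    using bump_recoils[OF assms(1-3)] by blast
  then show ?thesis using card_image[OF inj_on_subset[OF inj_bump subset_UNIV]] by metis
qed

text \<open>The new first entry precedes \<open>v\<close> and creates the recoil \<open>v\<close>,
  which \<tau> did not have; the old recoils are relabelled injectively.\<close>

lemma bump_recoils_Suc:
  assumes "\<tau> \<in> Sn n" "v \<in> set \<tau>" "\<not> subseq [Suc v, v] \<tau>"
  shows "card (recoils (Suc v # map (bump (Suc v)) \<tau>)) = Suc (card (recoils \<tau>))"
proof -
  have "Suc v \<le> Suc n" using assms by (auto simp: Sn_iff)
  then have "recoils (Suc v # map (bump (Suc v)) \<tau>) = insert v (bump (Suc v) ` recoils \<tau>)"
    using bump_recoils[OF assms(1), of "Suc v"] assms(2) by auto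
  moreover have "v \<notin> bump (Suc v) ` recoils \<tau>"
  proof
    assume "v \<in> bump (Suc v) ` recoils \<tau>"
    then have "v \<in> recoils \<tau>" by (auto simp: bump_def split: if_splits)
    then show False using assms recoils_eq[OF assms(1)] by simp
  qed
  ultimately show ?thesis
    by (simp add: card_image[OF inj_on_subset[OF inj_bump subset_UNIV]] finite_recoils)
qed

section \<open>Counting by the number of recoils\<close>

definition cnt :: "(nat list \<Rightarrow> bool) \<Rightarrow> nat \<Rightarrow> nat \<Rightarrow> nat" where
  "cnt P n k = card {\<pi> \<in> Sn n. P \<pi> \<and> card (recoils \<pi>) = k}"

text \<open>The counting form of a bijection \<open>f\<close> that raises the number of recoils by
  \<open>d\<close>. The case \<open>k < d\<close> is separated because subtraction
  truncates.\<close>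

lemma cnt_transfer:
  assumes "inj_on f {\<tau> \<in> Sn m. P \<tau>}"
    and "\<And>\<tau>. \<tau> \<in> Sn m \<Longrightarrow> P \<tau> \<Longrightarrow> f \<tau> \<in> Sn n \<and> Q (f \<tau>)"
    and "\<And>\<tau>. \<tau> \<in> Sn m \<Longrightarrow> P \<tau> \<Longrightarrow> card (recoils (f \<tau>)) = card (recoils \<tau>) + d"
    and "\<And>\<pi>. \<pi> \<in> Sn n \<Longrightarrow> Q \<pi> \<Longrightarrow> \<exists>\<tau> \<in> Sn m. P \<tau> \<and> \<pi> = f \<tau>"
  shows "cnt Q n k = (if k < d then 0 else cnt P m (k - d))"
proof -
  let ?A = "{\<tau> \<in> Sn m. P \<tau> \<and> card (recoils \<tau>) + d = k}"
  have "{\<pi> \<in> Sn n. Q \<pi> \<and> card (recoils \<pi>) = k} = f ` ?A"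
    using assms(2-4) by fastforce
  moreover have "inj_on f ?A" using assms(1) by (rule inj_on_subset) auto
  ultimately have "cnt Q n k = card ?A" by (simp add: cnt_def card_image)
  then show ?thesis by (auto simp: cnt_def intro!: arg_cong[of _ _ card])
qed

lemma cnt_split:
  assumes "\<And>\<pi>. \<pi> \<in> Sn n \<Longrightarrow> P \<pi> \<longleftrightarrow> Q \<pi> \<or> R \<pi>" "\<And>\<pi>. \<pi> \<in> Sn n \<Longrightarrow> \<not> (Q \<pi> \<and> R \<pi>)"
  shows "cnt P n k = cnt Q n k + cnt R n k"
proof -
  have "{\<pi> \<in> Sn n. P \<pi> \<and> card (recoils \<pi>) = k} =
      {\<pi> \<in> Sn n. Q \<pi> \<and> card (recoils \<pi>) = k} \<union> {\<pi> \<in> Sn n. R \<pi> \<and> card (recoils \<pi>) = k}"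
    using assms(1) by blast
  moreover have "finite {\<pi> \<in> Sn n. T \<pi>}" for T by (simp add: Sn_def)
  ultimately show ?thesis
    unfolding cnt_def using assms(2)
    by (simp only:) (rule card_Un_disjoint, auto)
qed

lemma cnt_eq_0: "(\<And>\<pi>. \<pi> \<in> Sn n \<Longrightarrow> \<not> P \<pi>) \<Longrightarrow> cnt P n k = 0"
  unfolding cnt_def by (metis (mono_tags, lifting) Collect_empty_eq card.empty)

section \<open>Avoidance under insertion of an entry\<close>

text \<open>The least entry \<open>m\<close> can only play the 1 of a pattern. The first condition
  on \<open>P\<close> and \<open>Q\<close> expresses 2413 and 4213, the second 3214, and the third
  4132.\<close>

lemma evil_insert_min:
  assumes "\<forall>x \<in> set P \<union> set Q. m < x"
  shows "evil_avoiding (P @ m # Q) \<longleftrightarrow> evil_avoiding (P @ Q) \<and>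
    (\<forall>x \<in> set P. \<forall>y \<in> set P. \<forall>q \<in> set Q. \<not> (x < q \<and> q < y)) \<and>
    (\<forall>x y. subseq [x, y] P \<longrightarrow> (\<forall>q \<in> set Q. \<not> (y < x \<and> x < q))) \<and>
    (\<forall>x y. subseq [x, y] Q \<longrightarrow> (\<forall>p \<in> set P. \<not> (y < x \<and> x < p)))"
    (is "_ \<longleftrightarrow> _ \<and> ?S1 \<and> ?S2 \<and> ?S3")
proof (intro iffI conjI)
  assume e: "evil_avoiding (P @ m # Q)"
  have "subseq (P @ Q) (P @ m # Q)" by (intro list_emb_append_mono) auto
  then show "evil_avoiding (P @ Q)" using e by (rule evil_avoiding_subseq)
  have *: "subseq [a, b, c, d] (P @ m # Q)"
    if "[a, b, c, d] = us @ m # vs" "subseq us P" "subseq vs Q" for a b c d us vs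
    unfolding that(1) using that(2,3) by (intro list_emb_append_mono) auto
  show ?S2
  proof (intro allI impI ballI notI)
    fix x y q assume xy: "subseq [x, y] P" "q \<in> set Q" "y < x \<and> x < q"
    moreover have "m < y" using assms subseq_set[OF xy(1)] by auto
    moreover have "subseq [x, y, m, q] (P @ m # Q)"
      using xy by (intro *[of _ _ _ _ "[x, y]" "[q]"]) (simp_all add: subseq_singleton_left)
    ultimately show False using evil_avoidingD(4)[OF e, of x y m q] by simp
  qed
  show ?S3
  proof (intro allI impI ballI notI)
    fix x y p assume xy: "subseq [x, y] Q" "p \<in> set P" "y < x \<and> x < p"
    moreover have "m < y" using assms subseq_set[OF xy(1)] by auto
    moreover have "subseq [p, m, x, y] (P @ m # Q)"
      using xy by (intro *[of _ _ _ _ "[p]" "[x, y]"]) (simp_all add: subseq_singleton_left)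
    ultimately show False using evil_avoidingD(2)[OF e, of p m x y] by simp
  qed
  show ?S1
  proof (intro ballI notI)
    fix x y q assume h: "x \<in> set P" "y \<in> set P" "q \<in> set Q" "x < q \<and> q < y"
    have "m < x" using assms h by simp
    \<comment> \<open>Whichever of \<open>x\<close> and \<open>y\<close> comes first, continuing
      with \<open>m\<close> and \<open>q\<close> gives 2413 or 4213.\<close>
    have "subseq [x, y] P \<or> subseq [y, x] P"
      using h(1,2,4) subseq_pair_iff_nth[of _ _ P] by (metis in_set_conv_nth nat_neq_iff order.asym)
    then have "subseq [x, y, m, q] (P @ m # Q) \<or> subseq [y, x, m, q] (P @ m # Q)"
      using h(3) *[of x y m q "[x, y]" "[q]"] *[of y x m q "[y, x]" "[q]"]
      by (auto simp: subseq_singleton_left)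
    then show False
      using evil_avoidingD(1)[OF e, of x y m q] evil_avoidingD(3)[OF e, of y x m q] h(4) \<open>m < x\<close>
      by auto
  qed
next
  assume h: "evil_avoiding (P @ Q) \<and> ?S1 \<and> ?S2 \<and> ?S3"
  note e = h[THEN conjunct1] and S1 = h[THEN conjunct2, THEN conjunct1]
    and S2 = h[THEN conjunct2, THEN conjunct2, THEN conjunct1]
    and S3 = h[THEN conjunct2, THEN conjunct2, THEN conjunct2]
  show "evil_avoiding (P @ m # Q)"
    unfolding evil_avoiding_iff
  proof (intro allI impI)
    fix a b c d assume "subseq [a, b, c, d] (P @ m # Q)"
    then show "\<not> (c < a \<and> a < d \<and> d < b) \<and> \<not> (b < d \<and> d < c \<and> c < a) \<and>
      \<not> (c < b \<and> b < d \<and> d < a) \<and> \<not> (c < b \<and> b < a \<and> a < d)" (is ?G)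
    proof (cases rule: subseq_insert_cases)
      case 1
      show ?thesis using evil_avoidingD[OF e 1] by (intro conjI)
    next
      case (2 us vs)
      have s: "set us \<subseteq> set P" "set vs \<subseteq> set Q" using 2 by (auto dest: subseq_set)
      \<comment> \<open>No pattern has its least entry first or last, so the outer two cases are
        immediate. The second place leaves 4132, the third place the other three patterns.\<close>
      consider "us = []" "m = a" "vs = [b, c, d]" | "us = [a]" "m = b" "vs = [c, d]"
        | "us = [a, b]" "m = c" "vs = [d]" | "us = [a, b, c]" "m = d" "vs = []"
        using 2(1) by (auto simp: Cons_eq_append_conv)
      then show ?G
      proof cases
        case 1
        then have "a < b" "a < c" "a < d" using s assms by auto
        then show ?G by auto
      next
        case c2: 2
        then have "b < a" "b < c" "b < d" "a \<in> set P" "subseq [c, d] Q" using s assms 2 by auto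
        moreover have "\<not> (d < c \<and> c < a)"
          using S3[rule_format, of c d a] calculation by simp
        ultimately show ?G by linarith
      next
        case 3
        then have "c < a" "c < b" "a \<in> set P" "b \<in> set P" "d \<in> set Q" "subseq [a, b] P"
          using s assms 2 by auto
        moreover have "\<not> (a < d \<and> d < b)" "\<not> (b < d \<and> d < a)" "\<not> (b < a \<and> a < d)"
          using S1[rule_format, of a b d] S1[rule_format, of b a d] S2[rule_format, of a b d]
            calculation by simp_all
        ultimately show ?G by linarith
      next
        case 4
        then have "d < a" "d < b" "d < c" using s assms by auto
        then show ?G by auto
      qed
    qed
  qed
qed

lemma evil_insert_minD:
  assumes "evil_avoiding (P @ m # Q)" "\<forall>x \<in> set P \<union> set Q. m < x"
  shows "evil_avoiding (P @ Q)"
    and "\<And>x y q. x \<in> set P \<Longrightarrow> y \<in> set P \<Longrightarrow> q \<in> set Q \<Longrightarrow> \<not> (x < q \<and> q < y)"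
    and "\<And>x y q. subseq [x, y] P \<Longrightarrow> q \<in> set Q \<Longrightarrow> \<not> (y < x \<and> x < q)"
    and "\<And>x y p. subseq [x, y] Q \<Longrightarrow> p \<in> set P \<Longrightarrow> \<not> (y < x \<and> x < p)"
proof -
  note E = evil_insert_min[OF assms(2), THEN iffD1, OF assms(1)]
  show "evil_avoiding (P @ Q)" by (rule E[THEN conjunct1])
  show "\<not> (x < q \<and> q < y)" if "x \<in> set P" "y \<in> set P" "q \<in> set Q" for x y q
    using E[THEN conjunct2, THEN conjunct1, rule_format, OF that] .
  show "\<not> (y < x \<and> x < q)" if "subseq [x, y] P" "q \<in> set Q" for x y q
    using E[THEN conjunct2, THEN conjunct2, THEN conjunct1, rule_format, OF that] .
  show "\<not> (y < x \<and> x < p)" if "subseq [x, y] Q" "p \<in> set P" for x y p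
    using E[THEN conjunct2, THEN conjunct2, THEN conjunct2, rule_format, OF that] .
qed

lemma evil_Cons_min: "\<forall>x \<in> set Q. m < x \<Longrightarrow> evil_avoiding (m # Q) \<longleftrightarrow> evil_avoiding Q"
  using evil_insert_min[of "[]" Q m] by simp

lemma evil_snoc_min: "\<forall>x \<in> set P. m < x \<Longrightarrow> evil_avoiding (P @ [m]) \<longleftrightarrow> evil_avoiding P"
  using evil_insert_min[of P "[]" m] by simp

section \<open>Avoidance when the first two entries are neighbours in value\<close>

text \<open>An occurrence that uses \<open>x\<close> but not \<open>y\<close> remains one after
  replacing \<open>x\<close> by \<open>y\<close>. One that uses both begins with an ascent, so it
  would be 2413, whose last entry would lie between \<open>x\<close> and \<open>y\<close>.\<close>

lemma evil_Cons_adjacent: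
  assumes "x < y" "\<forall>z \<in> set zs. \<not> (x < z \<and> z \<le> y)"
  shows "evil_avoiding (x # y # zs) \<longleftrightarrow> evil_avoiding (y # zs)"
proof
  assume h: "evil_avoiding (y # zs)"
  show "evil_avoiding (x # y # zs)"
    unfolding evil_avoiding_iff
  proof (intro allI impI)
    fix a b c d assume s: "subseq [a, b, c, d] (x # y # zs)"
    show "\<not> (c < a \<and> a < d \<and> d < b) \<and> \<not> (b < d \<and> d < c \<and> c < a) \<and>
      \<not> (c < b \<and> b < d \<and> d < a) \<and> \<not> (c < b \<and> b < a \<and> a < d)" (is ?G)
    proof (cases "subseq [a, b, c, d] (y # zs)")
      case True
      then show ?thesis using h unfolding evil_avoiding_iff by blast
    next
      case False
      with s have a: "a = x" and bcd: "subseq [b, c, d] (y # zs)"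
        using subseq_Cons_Cons_iff by metis+
      show ?G
      proof (cases "subseq [b, c, d] zs")
        case True
        then have "subseq [y, b, c, d] (y # zs)" by simp
        then have G: "\<not> (c < y \<and> y < d \<and> d < b) \<and> \<not> (b < d \<and> d < c \<and> c < y) \<and>
            \<not> (c < b \<and> b < d \<and> d < y) \<and> \<not> (c < b \<and> b < y \<and> y < d)"
          using h unfolding evil_avoiding_iff by blast
        have "b \<in> set zs" "c \<in> set zs" "d \<in> set zs" using subseq_set[OF True] by auto
        then have "b \<le> x \<or> y < b" "c \<le> x \<or> y < c" "d \<le> x \<or> y < d"
          using assms(2) by (meson not_le)+
        then show ?G using G a assms(1) by linarith
      next
        case F: False
        with bcd have b: "b = y" and cd: "subseq [c, d] zs"
          using subseq_Cons_Cons_iff by metis+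
        have "d \<in> set zs" using subseq_set[OF cd] by simp
        then show ?G using a b assms by auto
      qed
    qed
  qed
qed (metis evil_avoiding_subseq list_emb_Cons subseq_order.order_refl)

text \<open>An occurrence that uses only \<open>x\<close> may use \<open>y\<close> instead; one that
  uses both would need \<open>max c d\<close> strictly between \<open>x\<close> and
  \<open>y\<close>. The condition is symmetric in the first two entries, so either may be the
  larger.\<close>

lemma rectangular_Cons_adjacent:
  assumes "\<forall>z \<in> set zs. z < min x y \<or> max x y < z"
  shows "rectangular (x # y # zs) \<longleftrightarrow> rectangular (y # zs)"
proof
  assume h: "rectangular (y # zs)"
  show "rectangular (x # y # zs)"
    unfolding rectangular_iff
  proof (intro allI impI)
    fix a b c d assume s: "subseq [a, b, c, d] (x # y # zs)"
    show "\<not> (min c d < min a b \<and> min a b < max c d \<and> max c d < max a b)" (is ?G)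
    proof (cases "subseq [a, b, c, d] (y # zs)")
      case True
      then show ?thesis using h unfolding rectangular_iff by blast
    next
      case False
      with s have a: "a = x" and bcd: "subseq [b, c, d] (y # zs)"
        using subseq_Cons_Cons_iff by metis+
      show ?G
      proof (cases "subseq [b, c, d] zs")
        case True
        then have "subseq [y, b, c, d] (y # zs)" by simp
        then have G: "\<not> (min c d < min y b \<and> min y b < max c d \<and> max c d < max y b)"
          using h unfolding rectangular_iff by blast
        have "b \<in> set zs" "c \<in> set zs" "d \<in> set zs" using subseq_set[OF True] by auto
        then have "b < min x y \<or> max x y < b" "c < min x y \<or> max x y < c" "d < min x y \<or> max x y < d"
          using assms by auto
        then show ?G using G a by linarith
      next
        case F: False
        with bcd have b: "b = y" and cd: "subseq [c, d] zs"
          using subseq_Cons_Cons_iff by metis+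
        have "c \<in> set zs" "d \<in> set zs" using subseq_set[OF cd] by auto
        then have "c < min x y \<or> max x y < c" "d < min x y \<or> max x y < d"
          using assms by auto
        then show ?G using a b by linarith
      qed
    qed
  qed
qed (metis rectangular_subseq list_emb_Cons subseq_order.order_refl)

text \<open>At most one entry precedes \<open>m\<close>, so \<open>m\<close> is first or second in
  any occurrence using it, while the least entry of a forbidden pattern is third or fourth.\<close>

lemma rectangular_insert_min:
  assumes "length P \<le> 1" "\<forall>x \<in> set P \<union> set Q. m < x"
  shows "rectangular (P @ m # Q) \<longleftrightarrow> rectangular (P @ Q)"
proof
  assume "rectangular (P @ m # Q)"
  moreover have "subseq (P @ Q) (P @ m # Q)" by (intro list_emb_append_mono) auto
  ultimately show "rectangular (P @ Q)" using rectangular_subseq by blast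
next
  assume h: "rectangular (P @ Q)"
  show "rectangular (P @ m # Q)"
    unfolding rectangular_iff
  proof (intro allI impI)
    fix a b c d assume "subseq [a, b, c, d] (P @ m # Q)"
    then show "\<not> (min c d < min a b \<and> min a b < max c d \<and> max c d < max a b)" (is ?G)
    proof (cases rule: subseq_insert_cases)
      case 1
      then show ?thesis using h unfolding rectangular_iff by blast
    next
      case (2 us vs)
      have "length us \<le> 1" using assms(1) 2(2) list_emb_length le_trans by blast
      then consider "m = a" "vs = [b, c, d]" | "us = [a]" "m = b" "vs = [c, d]"
        using 2(1) by (auto simp: Cons_eq_append_conv)
      then have "min a b < c \<and> min a b < d"
        using assms(2) subseq_set[OF 2(2)] subseq_set[OF 2(3)] by cases auto
      then show ?G by auto
    qed
  qed
qed

section \<open>Rectangular permutations\<close>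

text \<open>Its counts within a class are the numbers e(n,k) of the overview. Nonemptiness is
  required because \<open>hd []\<close> is unspecified.\<close>

definition late_one :: "nat list \<Rightarrow> bool" where
  "late_one \<pi> \<longleftrightarrow> \<pi> \<noteq> [] \<and> hd \<pi> \<noteq> 1"

lemma Sn_Cons_bounds:
  assumes "x # xs \<in> Sn n"
  shows "1 \<le> x" "x \<le> n" "x \<notin> set xs" "distinct xs" "0 \<notin> set xs"
  using assms by (auto simp: Sn_iff)

lemma Sn_Suc_Cons:
  assumes "\<pi> \<in> Sn (Suc n)"
  obtains a \<tau> where "\<pi> = a # \<tau>" "1 \<le> a" "a \<le> Suc n" "a \<notin> set \<tau>"
proof (cases \<pi>)
  case Nil
  then show thesis using assms by (simp add: Sn_iff)
next
  case (Cons a \<tau>)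
  show thesis by (rule that[OF Cons Sn_Cons_bounds(1-3)[OF assms[unfolded Cons]]])
qed

lemma strict_mono_Suc: "strict_mono Suc"
  by (simp add: strict_mono_def)

lemma map_Suc_gt_one:
  assumes "\<tau> \<in> Sn n" "map Suc \<tau> = P @ Q"
  shows "\<forall>x \<in> set P \<union> set Q. 1 < x"
proof -
  have "\<forall>x \<in> set (map Suc \<tau>). 1 < x" using assms(1) by (auto simp: Sn_iff)
  then show ?thesis unfolding assms(2) by simp
qed

text \<open>The recurrence a(n+1,k) = a(n,k) + e(n+1,k) of the overview: a leading 1 can be removed
  without losing a recoil, since 2 is never to its left.\<close>

lemma cnt_Suc:
  assumes "\<And>\<tau>. \<tau> \<in> Sn n \<Longrightarrow> P (1 # map Suc \<tau>) \<longleftrightarrow> P \<tau>"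
  shows "cnt P (Suc n) k = cnt P n k + cnt (\<lambda>\<pi>. P \<pi> \<and> late_one \<pi>) (Suc n) k"
proof -
  have "cnt P (Suc n) k = cnt (\<lambda>\<pi>. P \<pi> \<and> (\<exists>Q. \<pi> = 1 # Q)) (Suc n) k
      + cnt (\<lambda>\<pi>. P \<pi> \<and> late_one \<pi>) (Suc n) k"
  proof (rule cnt_split)
    fix \<pi> assume "\<pi> \<in> Sn (Suc n)"
    then obtain a \<tau> where "\<pi> = a # \<tau>" by (rule Sn_Suc_Cons)
    then show "P \<pi> \<longleftrightarrow> P \<pi> \<and> (\<exists>Q. \<pi> = 1 # Q) \<or> P \<pi> \<and> late_one \<pi>"
      "\<not> ((P \<pi> \<and> (\<exists>Q. \<pi> = 1 # Q)) \<and> P \<pi> \<and> late_one \<pi>)"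
      by (auto simp: late_one_def)
  qed
  also have "cnt (\<lambda>\<pi>. P \<pi> \<and> (\<exists>Q. \<pi> = 1 # Q)) (Suc n) k = (if k < 0 then 0 else cnt P n (k - 0))"
  proof (rule cnt_transfer[where f = "\<lambda>\<tau>. 1 # map Suc \<tau>"])
    show "inj_on (\<lambda>\<tau>. 1 # map Suc \<tau>) {\<tau> \<in> Sn n. P \<tau>}"
      by (auto intro!: inj_onI)
  next
    fix \<tau> assume \<tau>: "\<tau> \<in> Sn n" "P \<tau>"
    then show "1 # map Suc \<tau> \<in> Sn (Suc n) \<and> P (1 # map Suc \<tau>) \<and> (\<exists>Q. 1 # map Suc \<tau> = 1 # Q)"
      using insert_one_perm[of \<tau> "[]" "map Suc \<tau>" n] assms[of \<tau>] by simp
    show "card (recoils (1 # map Suc \<tau>)) = card (recoils \<tau>) + 0"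
      using insert_one_recoils[OF \<tau>(1), of "[]" "map Suc \<tau>"] by simp
  next
    fix \<pi> assume \<pi>: "\<pi> \<in> Sn (Suc n)" "P \<pi> \<and> (\<exists>Q. \<pi> = 1 # Q)"
    then obtain Q where Q: "\<pi> = [] @ 1 # Q" by auto
    then obtain \<tau> where "\<tau> \<in> Sn n" "map Suc \<tau> = [] @ Q" using \<pi>(1) delete_one_perm by metis
    then show "\<exists>\<tau> \<in> Sn n. P \<tau> \<and> \<pi> = 1 # map Suc \<tau>" using Q \<pi>(2) assms by force
  qed
  finally show ?thesis by simp
qed

lemma rectangular_one_Cons: "\<tau> \<in> Sn n \<Longrightarrow> rectangular (1 # map Suc \<tau>) \<longleftrightarrow> rectangular \<tau>"
  using rectangular_insert_min[of "[]" "map Suc \<tau>" 1] rectangular_map[of Suc \<tau>]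
  by (auto simp: Sn_iff strict_mono_Suc)

text \<open>Since \<open>bump a a = Suc a\<close>, the first entry is doubled into the pair
  \<open>a\<close>, \<open>Suc a\<close>, which no later value separates.\<close>

lemma
  assumes "a # \<tau> \<in> Sn n"
  shows rectangular_bump_up: "rectangular (a # map (bump a) (a # \<tau>)) \<longleftrightarrow> rectangular (a # \<tau>)"
    and evil_bump_up: "evil_avoiding (a # map (bump a) (a # \<tau>)) \<longleftrightarrow> evil_avoiding (a # \<tau>)"
proof -
  have b: "bump a a = Suc a" by (simp add: bump_def)
  have z: "\<forall>z \<in> set (map (bump a) \<tau>). z < a \<or> Suc a < z"
  proof
    fix z assume "z \<in> set (map (bump a) \<tau>)"
    then obtain x where "x \<in> set \<tau>" "z = bump a x" by auto
    moreover from this have "x \<noteq> a" using Sn_Cons_bounds(3)[OF assms] by blast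
    ultimately show "z < a \<or> Suc a < z" by (simp add: bump_def)
  qed
  then have "rectangular (a # Suc a # map (bump a) \<tau>) \<longleftrightarrow> rectangular (Suc a # map (bump a) \<tau>)"
    by (intro rectangular_Cons_adjacent) simp
  then show "rectangular (a # map (bump a) (a # \<tau>)) \<longleftrightarrow> rectangular (a # \<tau>)"
    using rectangular_map[OF strict_mono_bump, of a "a # \<tau>"] b by simp
  have "evil_avoiding (a # Suc a # map (bump a) \<tau>) \<longleftrightarrow> evil_avoiding (Suc a # map (bump a) \<tau>)"
    by (intro evil_Cons_adjacent) (use z in force)+
  then show "evil_avoiding (a # map (bump a) (a # \<tau>)) \<longleftrightarrow> evil_avoiding (a # \<tau>)"
    using evil_avoiding_map[OF strict_mono_bump, of a "a # \<tau>"] b by simp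
qed

text \<open>Bumping at \<open>Suc a\<close> leaves \<open>a\<close> unchanged, so the first entry is
  doubled into the descending pair \<open>Suc a\<close>, \<open>a\<close>.\<close>

lemma rectangular_bump_down:
  assumes "a # \<tau> \<in> Sn n"
  shows "rectangular (Suc a # map (bump (Suc a)) (a # \<tau>)) \<longleftrightarrow> rectangular (a # \<tau>)"
proof -
  have b: "bump (Suc a) a = a" by (simp add: bump_def)
  have "\<forall>z \<in> set (map (bump (Suc a)) \<tau>). z < a \<or> Suc a < z"
    using Sn_Cons_bounds(3)[OF assms] by (auto simp: bump_def less_Suc_eq)
  then have "rectangular (Suc a # a # map (bump (Suc a)) \<tau>) \<longleftrightarrow> rectangular (a # map (bump (Suc a)) \<tau>)"
    by (intro rectangular_Cons_adjacent) simp
  then show ?thesis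
    using rectangular_map[OF strict_mono_bump, of "Suc a" "a # \<tau>"] b by simp
qed

text \<open>Doubling the first entry \<open>a\<close> into \<open>a\<close>, \<open>Suc a\<close>
  keeps the number of recoils, because \<open>a\<close> stands first and already precedes
  \<open>a - 1\<close>. The inverse deletes the first entry.\<close>

lemma cnt_bump_up:
  assumes "\<And>\<tau>. \<tau> \<in> Sn (Suc n) \<Longrightarrow> P \<tau> \<Longrightarrow> Q (hd \<tau> # map (bump (hd \<tau>)) \<tau>)"
    and "\<And>\<pi>. \<pi> \<in> Sn (Suc (Suc n)) \<Longrightarrow> Q \<pi> \<Longrightarrow> \<exists>x zs. \<pi> = x # Suc x # zs"
    and "\<And>\<tau>. \<tau> \<in> Sn (Suc n) \<Longrightarrow> Q (hd \<tau> # map (bump (hd \<tau>)) \<tau>) \<Longrightarrow> P \<tau>"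
  shows "cnt Q (Suc (Suc n)) k = cnt P (Suc n) k"
proof -
  let ?f = "\<lambda>\<tau>. hd \<tau> # map (bump (hd \<tau>)) \<tau>"
  have "cnt Q (Suc (Suc n)) k = (if k < 0 then 0 else cnt P (Suc n) (k - 0))"
  proof (rule cnt_transfer[where f = ?f])
    show "inj_on ?f {\<tau> \<in> Sn (Suc n). P \<tau>}"
      using inj_bump by (auto intro!: inj_onI simp: inj_map_eq_map)
  next
    fix \<tau> assume \<tau>: "\<tau> \<in> Sn (Suc n)" "P \<tau>"
    then obtain a \<tau>' where a: "\<tau> = a # \<tau>'" "1 \<le> a" "a \<le> Suc n" by (metis Sn_Suc_Cons)
    then show "?f \<tau> \<in> Sn (Suc (Suc n)) \<and> Q (?f \<tau>)"
      using bump_perm[of a "Suc n" \<tau>] assms(1)[OF \<tau>] \<tau> by simp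
    have "subseq [a, a - 1] \<tau>" if "a \<noteq> 1"
    proof -
      have "a - 1 \<in> set \<tau>" using a that \<tau>(1) by (auto simp: Sn_iff)
      then have "a - 1 \<in> set \<tau>'" using a by auto
      then show ?thesis using a(1) by (simp add: subseq_singleton_left)
    qed
    then show "card (recoils (?f \<tau>)) = card (recoils \<tau>) + 0"
      using bump_recoils_same[OF \<tau>(1), of a] a by simp
  next
    fix \<pi> assume \<pi>: "\<pi> \<in> Sn (Suc (Suc n))" "Q \<pi>"
    then obtain x zs where x: "\<pi> = x # Suc x # zs" using assms(2) by blast
    then obtain \<tau> where \<tau>: "\<tau> \<in> Sn (Suc n)" "Suc x # zs = map (bump x) \<tau>"
      using unbump_perm \<pi>(1) by blast
    then have "bump x (hd \<tau>) = Suc x" by (metis list.map_sel(1) list.sel(1) list.distinct(1) map_is_Nil_conv)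
    then have "hd \<tau> = x" by (auto simp: bump_def split: if_splits)
    then show "\<exists>\<tau> \<in> Sn (Suc n). P \<tau> \<and> \<pi> = ?f \<tau>"
      using x \<tau> \<pi>(2) assms(3) by (metis)
  qed
  then show ?thesis by simp
qed

text \<open>Deleting the first entry in \<open>?D\<close> and in \<open>?U\<close>, and the 1 in
  \<open>?M\<close>, gives the three terms; only \<open>?D\<close> loses a recoil. The permutations
  starting with 2, 1 are counted in \<open>?D\<close>.\<close>

lemma cnt_rectangular_late:
  "cnt (\<lambda>\<pi>. rectangular \<pi> \<and> late_one \<pi>) (Suc (Suc n)) k =
     (if k < 1 then 0 else cnt rectangular (Suc n) (k - 1))
      + 2 * cnt (\<lambda>\<pi>. rectangular \<pi> \<and> late_one \<pi>) (Suc n) k"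
proof -
  let ?D = "\<lambda>\<pi>. rectangular \<pi> \<and> (\<exists>y zs. \<pi> = Suc y # y # zs)"
  let ?U = "\<lambda>\<pi>. rectangular \<pi> \<and> late_one \<pi> \<and> (\<exists>x zs. \<pi> = x # Suc x # zs)"
  let ?M = "\<lambda>\<pi>. rectangular \<pi> \<and> (\<exists>x zs. \<pi> = x # 1 # zs \<and> x \<noteq> 2)"
  let ?E = "\<lambda>\<pi>. rectangular \<pi> \<and> late_one \<pi>"
  have "cnt ?E (Suc (Suc n)) k = cnt ?D (Suc (Suc n)) k + cnt (\<lambda>\<pi>. ?U \<pi> \<or> ?M \<pi>) (Suc (Suc n)) k"
  proof (rule cnt_split)
    fix \<pi> assume \<pi>: "\<pi> \<in> Sn (Suc (Suc n))"
    then have len: "length \<pi> = Suc (Suc n)" using distinct_card[of \<pi>] by (simp add: Sn_iff)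
    then obtain x y zs where p: "\<pi> = x # y # zs" by (auto simp: length_Suc_conv)
    note s = Sn_Cons_bounds[OF \<pi>[unfolded p]]
    have y1: "1 \<le> y" using \<pi> p by (auto simp: Sn_iff)
    show "\<not> (?D \<pi> \<and> (?U \<pi> \<or> ?M \<pi>))" using p by auto
    have "x = Suc y \<or> y = Suc x \<or> y = 1" if "rectangular \<pi>" "x \<noteq> 1"
    proof (rule ccontr)
      assume ne: "\<not> (x = Suc y \<or> y = Suc x \<or> y = 1)"
      have xy: "x \<noteq> y" using s p by auto
      \<comment> \<open>Some value strictly between \<open>x\<close> and \<open>y\<close> is wanted:
        it and 1 both come later, and in either order they complete a forbidden pattern.\<close>
      define z where "z = Suc (min x y)"
      have z: "min x y < z" "z < max x y" using ne xy unfolding z_def by auto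
      have S: "set \<pi> = {1..Suc (Suc n)}" using \<pi> by (simp only: Sn_iff)
      have "y \<in> set \<pi>" using p by simp
      then have "y \<le> Suc (Suc n)" using S by simp
      then have "1 \<in> set \<pi>" "z \<in> set \<pi>" using S z s y1 by auto
      then have "1 \<in> set zs" "z \<in> set zs" using p ne that z by (auto simp: min_def max_def split: if_splits)
      moreover have "1 \<noteq> z" using z s y1 by auto
      ultimately have "subseq [1, z] zs \<or> subseq [z, 1] zs"
        using subseq_pair_iff_nth[of _ _ zs] by (metis in_set_conv_nth nat_neq_iff)
      then have "subseq [x, y, 1, z] \<pi> \<or> subseq [x, y, z, 1] \<pi>" using p by auto
      moreover have "1 < min x y" using s y1 ne that by auto
      moreover have "min 1 z = 1" "min z 1 = 1" "max 1 z = z" "max z 1 = z"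
        using z s y1 by auto
      ultimately show False
        using z rectangular_iff[THEN iffD1, rule_format, OF \<open>rectangular \<pi>\<close>, of x y 1 z]
          rectangular_iff[THEN iffD1, rule_format, OF \<open>rectangular \<pi>\<close>, of x y z 1]
        by metis
    qed
    then show "?E \<pi> \<longleftrightarrow> ?D \<pi> \<or> (?U \<pi> \<or> ?M \<pi>)"
      using p s y1 by (auto simp: late_one_def)
  qed
  also have "cnt (\<lambda>\<pi>. ?U \<pi> \<or> ?M \<pi>) (Suc (Suc n)) k = cnt ?U (Suc (Suc n)) k + cnt ?M (Suc (Suc n)) k"
    by (rule cnt_split) (auto dest: Sn_Cons_bounds(1))
  also have "cnt ?U (Suc (Suc n)) k = cnt ?E (Suc n) k"
  proof (rule cnt_bump_up)
    fix \<tau> assume \<tau>: "\<tau> \<in> Sn (Suc n)"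
    then obtain a \<tau>' where a: "\<tau> = a # \<tau>'" by (metis Sn_Suc_Cons)
    show "?U (hd \<tau> # map (bump (hd \<tau>)) \<tau>)" if "?E \<tau>"
      using that rectangular_bump_up[OF \<tau>[unfolded a]] a by (auto simp: late_one_def bump_def)
    show "?E \<tau>" if "?U (hd \<tau> # map (bump (hd \<tau>)) \<tau>)"
      using that rectangular_bump_up[OF \<tau>[unfolded a]] a by (auto simp: late_one_def)
  qed auto
  also have "cnt ?D (Suc (Suc n)) k = (if k < 1 then 0 else cnt rectangular (Suc n) (k - 1))"
  proof (rule cnt_transfer[where f = "\<lambda>\<tau>. Suc (hd \<tau>) # map (bump (Suc (hd \<tau>))) \<tau>"])
    show "inj_on (\<lambda>\<tau>. Suc (hd \<tau>) # map (bump (Suc (hd \<tau>))) \<tau>) {\<tau> \<in> Sn (Suc n). rectangular \<tau>}"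
      using inj_bump by (auto intro!: inj_onI simp: inj_map_eq_map)
  next
    fix \<tau> assume \<tau>: "\<tau> \<in> Sn (Suc n)" "rectangular \<tau>"
    then obtain a \<tau>' where a: "\<tau> = a # \<tau>'" "1 \<le> a" "a \<le> Suc n" "a \<notin> set \<tau>'" by (metis Sn_Suc_Cons)
    have "Suc a # map (bump (Suc a)) \<tau> = Suc a # a # map (bump (Suc a)) \<tau>'"
      using a by (simp add: bump_def)
    then show "Suc (hd \<tau>) # map (bump (Suc (hd \<tau>))) \<tau> \<in> Sn (Suc (Suc n)) \<and>
        ?D (Suc (hd \<tau>) # map (bump (Suc (hd \<tau>))) \<tau>)"
      using bump_perm[of "Suc a" "Suc n" \<tau>] rectangular_bump_down[of a \<tau>'] \<tau> a by auto
    \<comment> \<open>Nothing precedes the first entry \<open>a\<close> of \<tau>, so putting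
      \<open>Suc a\<close> in front adds exactly one recoil.\<close>
    have "\<not> subseq [Suc a, a] \<tau>"
      using a subseq_set[of "[Suc a, a]" \<tau>'] by auto
    then show "card (recoils (Suc (hd \<tau>) # map (bump (Suc (hd \<tau>))) \<tau>)) = card (recoils \<tau>) + 1"
      using bump_recoils_Suc[OF \<tau>(1), of a] a by simp
  next
    fix \<pi> assume \<pi>: "\<pi> \<in> Sn (Suc (Suc n))" "?D \<pi>"
    then obtain y zs where x: "\<pi> = Suc y # y # zs" by blast
    then obtain \<tau> where \<tau>: "\<tau> \<in> Sn (Suc n)" "y # zs = map (bump (Suc y)) \<tau>"
      using unbump_perm \<pi>(1) by blast
    then obtain a \<tau>' where a: "\<tau> = a # \<tau>'" by (metis Sn_Suc_Cons)
    then have "bump (Suc y) a = y" using \<tau>(2) by simp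
    then have ay: "a = y" by (auto simp: bump_def split: if_splits)
    then have "rectangular \<tau>" "\<pi> = Suc (hd \<tau>) # map (bump (Suc (hd \<tau>))) \<tau>"
      using x \<tau> \<pi>(2) a rectangular_bump_down[of a \<tau>'] by auto
    then show "\<exists>\<tau> \<in> Sn (Suc n). rectangular \<tau> \<and> \<pi> = Suc (hd \<tau>) # map (bump (Suc (hd \<tau>))) \<tau>"
      using \<tau>(1) by blast
  qed
  \<comment> \<open>The condition \<open>x \<noteq> 2\<close> says both that deleting 1 leaves a
    permutation not starting with 1 and that 2 does not precede 1, so no recoil is lost.\<close>
  also have "cnt ?M (Suc (Suc n)) k = (if k < 0 then 0 else cnt ?E (Suc n) (k - 0))"
  proof (rule cnt_transfer[where f = "\<lambda>\<tau>. Suc (hd \<tau>) # 1 # map Suc (tl \<tau>)"])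
    show "inj_on (\<lambda>\<tau>. Suc (hd \<tau>) # 1 # map Suc (tl \<tau>)) {\<tau> \<in> Sn (Suc n). ?E \<tau>}"
    proof (rule inj_onI)
      fix \<sigma> \<tau>
      assume "\<sigma> \<in> {\<tau> \<in> Sn (Suc n). ?E \<tau>}" "\<tau> \<in> {\<tau> \<in> Sn (Suc n). ?E \<tau>}"
        and eq: "Suc (hd \<sigma>) # 1 # map Suc (tl \<sigma>) = Suc (hd \<tau>) # 1 # map Suc (tl \<tau>)"
      then have "\<sigma> \<noteq> []" "\<tau> \<noteq> []" by (auto simp: late_one_def)
      moreover have "hd \<sigma> = hd \<tau>" "tl \<sigma> = tl \<tau>" using eq by simp_all
      ultimately show "\<sigma> = \<tau>" by (metis list.expand)
    qed
  next
    fix \<tau> assume \<tau>: "\<tau> \<in> Sn (Suc n)" "?E \<tau>"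
    then obtain a \<tau>' where a: "\<tau> = a # \<tau>'" by (metis Sn_Suc_Cons)
    have eq: "map Suc \<tau> = [Suc a] @ map Suc \<tau>'" using a by simp
    note min = map_Suc_gt_one[OF \<tau>(1) eq]
    have "rectangular ([Suc a] @ 1 # map Suc \<tau>')"
      using rectangular_insert_min[OF _ min] \<tau>(2) rectangular_map[of Suc \<tau>] eq strict_mono_Suc by simp
    then show "Suc (hd \<tau>) # 1 # map Suc (tl \<tau>) \<in> Sn (Suc (Suc n)) \<and> ?M (Suc (hd \<tau>) # 1 # map Suc (tl \<tau>))"
      using insert_one_perm[OF eq, of "Suc n"] a \<tau> by (auto simp: late_one_def)
    show "card (recoils (Suc (hd \<tau>) # 1 # map Suc (tl \<tau>))) = card (recoils \<tau>) + 0"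
      using insert_one_recoils[OF \<tau>(1) eq] a \<tau>(2) by (auto simp: late_one_def)
  next
    fix \<pi> assume \<pi>: "\<pi> \<in> Sn (Suc (Suc n))" "?M \<pi>"
    then obtain x zs where x: "\<pi> = [x] @ 1 # zs" "x \<noteq> 2" by auto
    then obtain \<tau> where \<tau>: "\<tau> \<in> Sn (Suc n)" "map Suc \<tau> = [x] @ zs"
      using delete_one_perm \<pi>(1) by metis
    then obtain a \<tau>' where a: "\<tau> = a # \<tau>'" "x = Suc a" "zs = map Suc \<tau>'" by auto
    note min = map_Suc_gt_one[OF \<tau>]
    have "rectangular \<tau>"
      using rectangular_insert_min[OF _ min] \<pi>(2) rectangular_map[of Suc \<tau>] \<tau>(2) x strict_mono_Suc by simp
    then show "\<exists>\<tau> \<in> Sn (Suc n). ?E \<tau> \<and> \<pi> = Suc (hd \<tau>) # 1 # map Suc (tl \<tau>)"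
      using \<tau>(1) a x by (intro bexI[of _ \<tau>]) (auto simp: late_one_def)
  qed
  finally show ?thesis by simp
qed

section \<open>Evil-avoiding permutations\<close>

lemma evil_one_Cons: "\<tau> \<in> Sn n \<Longrightarrow> evil_avoiding (1 # map Suc \<tau>) \<longleftrightarrow> evil_avoiding \<tau>"
  using evil_Cons_min[of "map Suc \<tau>" 1] evil_avoiding_map[OF strict_mono_Suc, of \<tau>]
  by (auto simp: Sn_iff)

lemma Sn_split_one:
  assumes "\<pi> \<in> Sn (Suc n)"
  obtains P Q where "\<pi> = P @ 1 # Q" "1 \<notin> set P" "1 \<notin> set Q" "late_one \<pi> \<longleftrightarrow> P \<noteq> []"
proof -
  have "1 \<in> set \<pi>" "distinct \<pi>" using assms by (auto simp: Sn_iff)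
  then obtain P Q where PQ: "\<pi> = P @ 1 # Q" by (metis split_list)
  have "1 \<notin> set P" "1 \<notin> set Q" using \<open>distinct \<pi>\<close> unfolding PQ by auto
  moreover from this have "late_one \<pi> \<longleftrightarrow> P \<noteq> []"
    unfolding PQ late_one_def by (cases P) auto
  ultimately show thesis using that PQ by blast
qed

text \<open>Lets existential descriptions such as \<open>gapped\<close> be tested on one fixed pair
  \<open>P\<close>, \<open>Q\<close>.\<close>

lemma Sn_split_one_unique:
  assumes "P @ 1 # Q \<in> Sn n" "P @ 1 # Q = P' @ 1 # Q'"
  shows "P = P'" "Q = Q'"
proof -
  have "1 \<notin> set P" "1 \<notin> set Q" using assms(1) by (auto simp: Sn_iff)
  then show "P = P'" "Q = Q'" using assms(2) append_Cons_eq_iff[of 1 P Q P' Q'] by auto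
qed

lemma Sn_split_one_gt:
  assumes "P @ 1 # Q \<in> Sn n"
  shows "\<forall>x \<in> set P \<union> set Q. 1 < x"
proof
  fix x assume x: "x \<in> set P \<union> set Q"
  have "x \<in> set (P @ 1 # Q)" using x by auto
  then have "1 \<le> x" using assms by (auto simp only: Sn_iff atLeastAtMost_iff)
  moreover have "x \<noteq> 1" using x assms by (auto simp: Sn_iff)
  ultimately show "1 < x" by simp
qed

section \<open>Evil-avoiding permutations according to what follows 1\<close>

text \<open>The third case of the overview, counted there by b(n,k).\<close>

definition gapped :: "nat list \<Rightarrow> bool" where
  "gapped \<pi> \<longleftrightarrow> (\<exists>P h Q. P \<noteq> [] \<and> h \<noteq> 2 \<and> \<pi> = P @ 1 # h # Q)"

text \<open>If some \<open>p\<close> in \<open>P\<close> exceeded \<open>h\<close>, then 2 in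
  \<open>P\<close> would give 2413 or 4213 with \<open>p\<close>, 1, \<open>h\<close>, and 2 in
  \<open>Q\<close> would give 4132 as \<open>p\<close>, 1, \<open>h\<close>, 2. So \<open>P\<close>
  lies below \<open>h\<close>, and a descent in \<open>P\<close> followed by 1 and \<open>h\<close>
  would be 3214.\<close>

lemma evil_gapped_prefix:
  assumes \<pi>: "P @ 1 # h # Q \<in> Sn n" and e: "evil_avoiding (P @ 1 # h # Q)" and h: "h \<noteq> 2"
  shows "\<And>p. p \<in> set P \<Longrightarrow> p < h"
    and "\<And>x y. subseq [x, y] P \<Longrightarrow> x < y"
    and "\<And>x y q. x \<in> set P \<Longrightarrow> y \<in> set P \<Longrightarrow> q \<in> set (h # Q) \<Longrightarrow> \<not> (x < q \<and> q < y)"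
proof -
  note min = Sn_split_one_gt[OF \<pi>]
  note S1 = evil_insert_minD(2)[OF e min] and S2 = evil_insert_minD(3)[OF e min]
    and S3 = evil_insert_minD(4)[OF e min]
  show "\<not> (x < q \<and> q < y)" if "x \<in> set P" "y \<in> set P" "q \<in> set (h # Q)" for x y q
    using S1 that by blast
  have dist: "distinct (P @ 1 # h # Q)" and S: "set (P @ 1 # h # Q) = {1..n}"
    using \<pi> by (simp_all only: Sn_iff)
  have h2: "2 < h" using min h by auto
  show less: "p < h" if p: "p \<in> set P" for p
  proof (rule ccontr)
    assume "\<not> p < h"
    moreover have "p \<noteq> h" using dist p by auto
    ultimately have hp: "h < p" by simp
    have "h \<in> {1..n}" using S by auto
    then have "2 \<in> set (P @ 1 # h # Q)" unfolding S using h2 by simp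
    then consider "2 \<in> set P" | "2 \<in> set Q" using h2 by auto
    then show False
    proof cases
      case 1
      then show False using S1[of 2 p h] p h2 hp by simp
    next
      case 2
      then have "subseq [h, 2] (h # Q)" by (simp add: subseq_singleton_left)
      then show False using S3[of h 2 p] p h2 hp by simp
    qed
  qed
  show "x < y" if xy: "subseq [x, y] P" for x y
  proof -
    have "x \<in> set P" using subseq_set[OF xy] by simp
    then have "\<not> y < x" using S2[OF xy, of h] less[of x] by simp
    moreover have "x \<noteq> y" using subseq_pair_asym[OF _ xy] xy dist by auto
    ultimately show ?thesis by simp
  qed
qed

text \<open>A final 1 (\<open>?L\<close>) forms a recoil with 2 and can be appended to any
  evil-avoiding permutation. In \<open>?A\<close> the adjacent entries 1 and 2 are merged, with no
  change in the number of recoils because 2 follows 1.\<close>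

lemma cnt_evil_late_split:
  "cnt (\<lambda>\<pi>. evil_avoiding \<pi> \<and> late_one \<pi>) (Suc (Suc n)) k =
     (if k < 1 then 0 else cnt evil_avoiding (Suc n) (k - 1))
     + cnt (\<lambda>\<pi>. evil_avoiding \<pi> \<and> late_one \<pi>) (Suc n) k
     + cnt (\<lambda>\<pi>. evil_avoiding \<pi> \<and> gapped \<pi>) (Suc (Suc n)) k"
proof -
  let ?E = "\<lambda>\<pi>. evil_avoiding \<pi> \<and> late_one \<pi>"
  let ?L = "\<lambda>\<pi>. evil_avoiding \<pi> \<and> (\<exists>P. P \<noteq> [] \<and> \<pi> = P @ [1])"
  let ?A = "\<lambda>\<pi>. evil_avoiding \<pi> \<and> (\<exists>P Q. P \<noteq> [] \<and> \<pi> = P @ 1 # 2 # Q)"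
  let ?B = "\<lambda>\<pi>. evil_avoiding \<pi> \<and> gapped \<pi>"
  have "cnt ?E (Suc (Suc n)) k = cnt (\<lambda>\<pi>. ?L \<pi> \<or> ?A \<pi>) (Suc (Suc n)) k + cnt ?B (Suc (Suc n)) k"
  proof (rule cnt_split)
    fix \<pi> assume \<pi>: "\<pi> \<in> Sn (Suc (Suc n))"
    then obtain P Q where PQ: "\<pi> = P @ 1 # Q" "late_one \<pi> \<longleftrightarrow> P \<noteq> []" by (rule Sn_split_one)
    have u: "\<pi> = P' @ 1 # Q' \<longleftrightarrow> P' = P \<and> Q' = Q" for P' Q'
      using Sn_split_one_unique \<pi> PQ(1) by metis
    show "\<not> ((?L \<pi> \<or> ?A \<pi>) \<and> ?B \<pi>)"
      unfolding gapped_def u by auto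
    show "?E \<pi> \<longleftrightarrow> (?L \<pi> \<or> ?A \<pi>) \<or> ?B \<pi>"
      unfolding gapped_def u PQ(2) by (cases Q) auto
  qed
  also have "cnt (\<lambda>\<pi>. ?L \<pi> \<or> ?A \<pi>) (Suc (Suc n)) k = cnt ?L (Suc (Suc n)) k + cnt ?A (Suc (Suc n)) k"
  proof (rule cnt_split)
    fix \<pi> assume \<pi>: "\<pi> \<in> Sn (Suc (Suc n))"
    then obtain P Q where PQ: "\<pi> = P @ 1 # Q" by (rule Sn_split_one)
    have u: "\<pi> = P' @ 1 # Q' \<longleftrightarrow> P' = P \<and> Q' = Q" for P' Q'
      using Sn_split_one_unique \<pi> PQ(1) by metis
    show "\<not> (?L \<pi> \<and> ?A \<pi>)" unfolding u by auto
  qed simp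
  also have "cnt ?L (Suc (Suc n)) k = (if k < 1 then 0 else cnt evil_avoiding (Suc n) (k - 1))"
  proof (rule cnt_transfer[where f = "\<lambda>\<tau>. map Suc \<tau> @ [1]"])
    show "inj_on (\<lambda>\<tau>. map Suc \<tau> @ [1]) {\<tau> \<in> Sn (Suc n). evil_avoiding \<tau>}"
      by (auto intro!: inj_onI)
  next
    fix \<tau> assume \<tau>: "\<tau> \<in> Sn (Suc n)" "evil_avoiding \<tau>"
    have eq: "map Suc \<tau> = map Suc \<tau> @ []" by simp
    have "\<tau> \<noteq> []" using \<tau>(1) by (metis Sn_Suc_Cons list.distinct(1))
    then show "map Suc \<tau> @ [1] \<in> Sn (Suc (Suc n)) \<and> ?L (map Suc \<tau> @ [1])"
      using insert_one_perm[OF eq, of "Suc n"] map_Suc_gt_one[OF \<tau>(1) eq] \<tau>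
        evil_snoc_min[of "map Suc \<tau>" 1] evil_avoiding_map[OF strict_mono_Suc, of \<tau>] by auto
    have "1 \<in> set \<tau>" using \<tau>(1) by (auto simp: Sn_iff)
    then have "2 \<in> set (map Suc \<tau>)" by (force simp: numeral_2_eq_2)
    then show "card (recoils (map Suc \<tau> @ [1])) = card (recoils \<tau>) + 1"
      using insert_one_recoils[OF \<tau>(1) eq] by simp
  next
    fix \<pi> assume \<pi>: "\<pi> \<in> Sn (Suc (Suc n))" "?L \<pi>"
    then obtain P where P: "\<pi> = P @ 1 # []" by auto
    then obtain \<tau> where \<tau>: "\<tau> \<in> Sn (Suc n)" "map Suc \<tau> = P @ []" using \<pi>(1) delete_one_perm by metis
    have "evil_avoiding \<tau>"
      using P \<pi>(2) evil_snoc_min[of P 1] evil_avoiding_map[OF strict_mono_Suc, of \<tau>]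
        map_Suc_gt_one[OF \<tau>] \<tau>(2) by simp
    then show "\<exists>\<tau> \<in> Sn (Suc n). evil_avoiding \<tau> \<and> \<pi> = map Suc \<tau> @ [1]"
      using P \<tau> by (intro bexI[of _ \<tau>]) auto
  qed
  also have "cnt ?A (Suc (Suc n)) k = (if k < 0 then 0 else cnt ?E (Suc n) (k - 0))"
  proof (rule cnt_transfer)
    \<comment> \<open>The entry 1 becomes 1, 2 and all others are raised by one; working entrywise
      avoids choosing a decomposition of \<tau>.\<close>
    let ?f = "\<lambda>\<tau>. concat (map (\<lambda>x. if x = 1 then [1, 2] else [Suc x]) \<tau>)"
    have f: "?f (P @ 1 # Q) = map Suc P @ 1 # 2 # map Suc Q" if "1 \<notin> set P" "1 \<notin> set Q" for P Q
    proof -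
      have "?f xs = map Suc xs" if "1 \<notin> set xs" for xs using that by (induction xs) auto
      then show ?thesis using that by simp
    qed
    \<comment> \<open>Removing the 1 recovers \<tau>, hence injectivity. An entry 0 is excluded
      because it too would be sent to 1.\<close>
    have filt: "filter (\<lambda>x. x \<noteq> 1) (?f \<tau>) = map Suc \<tau>" if "0 \<notin> set \<tau>" for \<tau>
      using that by (induction \<tau>) auto
    show "inj_on ?f {\<tau> \<in> Sn (Suc n). ?E \<tau>}"
    proof (rule inj_onI)
      fix \<sigma> \<tau> assume "\<sigma> \<in> {\<tau> \<in> Sn (Suc n). ?E \<tau>}" "\<tau> \<in> {\<tau> \<in> Sn (Suc n). ?E \<tau>}"
        and eq: "?f \<sigma> = ?f \<tau>"
      then have 0: "0 \<notin> set \<sigma>" "0 \<notin> set \<tau>" by (auto simp: Sn_iff)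
      have "map Suc \<sigma> = map Suc \<tau>"
        unfolding filt[OF 0(1), symmetric] filt[OF 0(2), symmetric] eq by (rule refl)
      then show "\<sigma> = \<tau>" by simp
    qed
    \<comment> \<open>Beyond the conditions that hold at the minimum 2 of \<open>P @ 2 # Q\<close>,
      inserting 1 just before 2 only asks for those involving 2 itself, and these hold because 2 is
      below all other entries.\<close>
    have evil: "evil_avoiding (P @ 1 # 2 # Q) \<longleftrightarrow> evil_avoiding \<tau>"
      if \<tau>: "\<tau> \<in> Sn (Suc n)" and eq: "map Suc \<tau> = P @ 2 # Q" for P Q \<tau>
    proof
      have min: "\<forall>x \<in> set P \<union> set (2 # Q). 1 < x" by (rule map_Suc_gt_one[OF that])
      have \<tau>e: "evil_avoiding \<tau> \<longleftrightarrow> evil_avoiding (P @ 2 # Q)"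
        using evil_avoiding_map[OF strict_mono_Suc, of \<tau>] eq by simp
      show "evil_avoiding \<tau>" if "evil_avoiding (P @ 1 # 2 # Q)"
        unfolding \<tau>e by (rule evil_insert_minD(1)[OF that min])
      assume "evil_avoiding \<tau>"
      then have e: "evil_avoiding (P @ 2 # Q)" using \<tau>e by simp
      have "distinct (P @ 2 # Q)" using \<tau> unfolding eq[symmetric] by (auto simp: Sn_iff distinct_map)
      have min2: "\<forall>x \<in> set P \<union> set Q. 2 < x"
      proof
        fix x assume x: "x \<in> set P \<union> set Q"
        then have "1 < x" using min by simp
        moreover have "x \<noteq> 2" using x \<open>distinct (P @ 2 # Q)\<close> by auto
        ultimately show "2 < x" by simp
      qed
      note S1 = evil_insert_minD(2)[OF e min2] and S2 = evil_insert_minD(3)[OF e min2]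
        and S3 = evil_insert_minD(4)[OF e min2]
      show "evil_avoiding (P @ 1 # 2 # Q)"
        unfolding evil_insert_min[OF min]
      proof (intro conjI e ballI allI impI)
        show "\<not> (x < q \<and> q < y)" if "x \<in> set P" "y \<in> set P" "q \<in> set (2 # Q)" for x y q
        proof (cases "q = 2")
          case True
          moreover have "2 < x" using min2 that(1) by simp
          ultimately show ?thesis by simp
        next
          case False
          then show ?thesis using S1[of x y q] that by simp
        qed
        show "\<not> (y < x \<and> x < q)" if "subseq [x, y] P" "q \<in> set (2 # Q)" for x y q
        proof (cases "q = 2")
          case True
          moreover have "2 < x" using min2 subseq_set[OF that(1)] by simp
          ultimately show ?thesis by simp
        next
          case False
          then show ?thesis using S2[OF that(1), of q] that(2) by simp
        qed
        show "\<not> (y < x \<and> x < p)" if "subseq [x, y] (2 # Q)" "p \<in> set P" for x y p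
        proof (cases "subseq [x, y] Q")
          case True
          then show ?thesis using S3 that(2) by simp
        next
          case False
          then have "x = 2" "y \<in> set Q"
            using that(1) subseq_Cons_Cons_iff[of x "[y]" 2 Q] by (simp_all add: subseq_singleton_left)
          moreover from this have "2 < y" using min2 by simp
          ultimately show ?thesis by simp
        qed
      qed
    qed
    {
      fix \<tau> assume \<tau>: "\<tau> \<in> Sn (Suc n)" "?E \<tau>"
      then obtain P Q where PQ: "\<tau> = P @ 1 # Q" "1 \<notin> set P" "1 \<notin> set Q" "P \<noteq> []"
        by (metis Sn_split_one)
      have eq: "map Suc \<tau> = map Suc P @ 2 # map Suc Q" using PQ by simp
      show "?f \<tau> \<in> Sn (Suc (Suc n)) \<and> ?A (?f \<tau>)"
        using f[OF PQ(2,3)] insert_one_perm[OF eq, of "Suc n"] evil[OF \<tau>(1) eq] \<tau> PQ by auto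
      have "2 \<notin> set (map Suc P)" using PQ by auto
      then show "card (recoils (?f \<tau>)) = card (recoils \<tau>) + 0"
        using f[OF PQ(2,3)] insert_one_recoils[OF \<tau>(1) eq] PQ by simp
    next
      fix \<pi> assume \<pi>: "\<pi> \<in> Sn (Suc (Suc n))" "?A \<pi>"
      then obtain P Q where PQ: "\<pi> = P @ 1 # 2 # Q" "P \<noteq> []" by auto
      then obtain \<tau> where \<tau>: "\<tau> \<in> Sn (Suc n)" "map Suc \<tau> = P @ 2 # Q"
        using \<pi>(1) delete_one_perm by metis
      then obtain P' x Q' where P': "\<tau> = P' @ x # Q'" "P = map Suc P'" "Suc x = 2" "Q = map Suc Q'"
        by (auto simp: map_eq_append_conv map_eq_Cons_conv)
      then have x: "x = 1" by simp
      have 1: "1 \<notin> set P'" "1 \<notin> set Q'" using \<tau>(1) P' x by (auto simp: Sn_iff)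
      have "evil_avoiding \<tau>" using evil[OF \<tau>] \<pi>(2) PQ by simp
      moreover have "late_one \<tau>" using P' PQ 1 by (cases P') (auto simp: late_one_def)
      moreover have "\<pi> = ?f \<tau>" using f[OF 1] P' x PQ by simp
      ultimately show "\<exists>\<tau> \<in> Sn (Suc n). ?E \<tau> \<and> \<pi> = ?f \<tau>" using \<tau>(1) by blast
    }
  qed
  finally show ?thesis by simp
qed

lemma gapped_bump_up:
  assumes \<tau>: "a # \<tau> \<in> Sn n"
  shows "gapped (a # map (bump a) (a # \<tau>)) \<longleftrightarrow> gapped (a # \<tau>)"
proof
  assume "gapped (a # \<tau>)"
  then obtain P h Q where P: "P \<noteq> []" "h \<noteq> 2" "a # \<tau> = P @ 1 # h # Q"
    unfolding gapped_def by blast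
  note gt = Sn_split_one_gt[OF \<tau>[unfolded P(3)]]
  have "a \<in> set P" using P(1,3) by (cases P) auto
  then have "1 < a" using gt by simp
  moreover have "2 < h" using gt P(2) by simp
  ultimately have "a # map (bump a) (a # \<tau>) = (a # map (bump a) P) @ 1 # bump a h # map (bump a) Q"
    "bump a h \<noteq> 2"
    unfolding P(3) by (simp_all add: bump_def)
  then show "gapped (a # map (bump a) (a # \<tau>))" unfolding gapped_def by blast
next
  assume "gapped (a # map (bump a) (a # \<tau>))"
  then obtain P h Q where P: "P \<noteq> []" "h \<noteq> 2" "a # map (bump a) (a # \<tau>) = P @ 1 # h # Q"
    unfolding gapped_def by blast
  obtain P1 where P1: "P = a # P1" "map (bump a) (a # \<tau>) = P1 @ 1 # h # Q"
    using P(1,3) by (cases P) auto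
  obtain P2 vs where us: "a # \<tau> = P2 @ vs" "1 # h # Q = map (bump a) vs"
    using P1(2) unfolding map_eq_append_conv by metis
  then obtain x g Q2 where P2: "a # \<tau> = P2 @ x # g # Q2" "bump a x = 1" "bump a g = h"
    by (auto simp: Cons_eq_map_conv)
  have "0 \<notin> set (a # \<tau>)" using \<tau> by (auto simp: Sn_iff)
  then have x: "x = 1" using P2 by (auto simp: bump_def split: if_splits)
  have a: "a \<noteq> 1" using P2(2) x by (auto simp: bump_def)
  then have P2ne: "P2 \<noteq> []" using P2(1) x by (cases P2) auto
  then have "a \<in> set P2" using P2(1) by (cases P2) auto
  then have "a \<noteq> g" using \<tau> unfolding P2(1) by (auto simp: Sn_iff)
  moreover have "1 \<le> a" by (rule Sn_Cons_bounds(1)[OF \<tau>])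
  \<comment> \<open>If \<open>g = 2\<close>, then \<open>a\<close> is neither 1 nor 2, so
    \<open>bump a\<close> fixes 2 and \<open>h\<close> would be 2.\<close>
  ultimately have "g \<noteq> 2" using P2(3) P(2) a by (auto simp: bump_def split: if_splits)
  then show "gapped (a # \<tau>)" unfolding gapped_def using P2ne P2(1) x by blast
qed

text \<open>With one entry before 1 there is no pair in the prefix, so only the condition for 4132
  remains.\<close>

lemma evil_singleton_one:
  assumes "\<forall>x \<in> set [s] \<union> set R. 1 < x"
  shows "evil_avoiding (s # 1 # R) \<longleftrightarrow> evil_avoiding (s # R) \<and>
    (\<forall>x y. subseq [x, y] R \<longrightarrow> \<not> (y < x \<and> x < s))"
proof
  assume e: "evil_avoiding (s # 1 # R)"
  then have e': "evil_avoiding ([s] @ 1 # R)" by simp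
  show "evil_avoiding (s # R) \<and> (\<forall>x y. subseq [x, y] R \<longrightarrow> \<not> (y < x \<and> x < s))"
    using evil_insert_minD(1,4)[OF e' assms] by simp
next
  assume h: "evil_avoiding (s # R) \<and> (\<forall>x y. subseq [x, y] R \<longrightarrow> \<not> (y < x \<and> x < s))"
  have "evil_avoiding ([s] @ 1 # R)"
    unfolding evil_insert_min[OF assms]
  proof (intro conjI ballI allI impI)
    show "evil_avoiding ([s] @ R)" using h by simp
    show "\<not> (x < q \<and> q < y)" if "x \<in> set [s]" "y \<in> set [s]" for x y q using that by simp
    show "\<not> (y < x \<and> x < q)" if "subseq [x, y] [s]" for x y q
      using list_emb_length[OF that] by simp
    show "\<not> (y < x \<and> x < p)" if "subseq [x, y] R" "p \<in> set [s]" for x y p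
      using h that by simp
  qed
  then show "evil_avoiding (s # 1 # R)" by simp
qed

text \<open>Entries below the minimum \<open>v\<close> of the prefix before \<open>1\<close> form an increasing sequence,
  so only the pattern \<open>2413\<close> could use a new first entry just below \<open>v\<close>; there \<open>v\<close> itself
  can take its place.\<close>
lemma evil_bump_min:
  assumes \<rho>: "P @ 1 # Q \<in> Sn n" and e: "evil_avoiding (P @ 1 # Q)"
    and v: "v \<in> set P" "\<forall>x \<in> set P. v \<le> x"
  shows "\<And>x y. subseq [x, y] (P @ 1 # Q) \<Longrightarrow> \<not> (y < x \<and> x < v)"
    and "evil_avoiding (v # map (bump v) (P @ 1 # Q))"
proof -
  note gt = Sn_split_one_gt[OF \<rho>]
  note S1 = evil_insert_minD(2)[OF e gt] and S3 = evil_insert_minD(4)[OF e gt]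
  have dist: "distinct (P @ 1 # Q)" using \<rho> by (simp only: Sn_iff)
  \<comment> \<open>Once the first entry of a subsequence is outside \<open>P\<close>, the whole
    subsequence lies to the right of \<open>P\<close>.\<close>
  have tail: "subseq (x # ys) (1 # Q)" if "subseq (x # ys) (P @ 1 # Q)" "x \<notin> set P" for x ys
  proof -
    obtain us vs where uv: "x # ys = us @ vs" "subseq us P" "subseq vs (1 # Q)"
      using \<open>subseq (x # ys) (P @ 1 # Q)\<close> by (metis subseq_appendE)
    have "us = []" using uv(1) subseq_set[OF uv(2)] that(2) by (cases us) auto
    then show ?thesis using uv by simp
  qed
  show low: "\<not> (y < x \<and> x < v)" if xy: "subseq [x, y] (P @ 1 # Q)" for x y
  proof
    assume a: "y < x \<and> x < v"
    then have "x \<notin> set P" using v(2) by (metis not_le)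
    then have t: "subseq [x, y] (1 # Q)" using tail xy by blast
    then have "y \<in> set (1 # Q)" using subseq_set by fastforce
    then have "y = 1 \<or> 1 < y" using gt by (metis UnI2 set_ConsD)
    then have "x \<noteq> 1" using a by auto
    then have "subseq [x, y] Q" using t subseq_Cons_Cons_iff[of x "[y]" 1 Q] by simp
    then show False using S3 v(1) a by blast
  qed
  let ?\<rho> = "P @ 1 # Q"
  show "evil_avoiding (v # map (bump v) ?\<rho>)"
    unfolding evil_avoiding_iff
  proof (intro allI impI)
    fix a b c d assume s: "subseq [a, b, c, d] (v # map (bump v) ?\<rho>)"
    have em: "evil_avoiding (map (bump v) ?\<rho>)"
      using e evil_avoiding_map[OF strict_mono_bump] by blast
    show "\<not> (c < a \<and> a < d \<and> d < b) \<and> \<not> (b < d \<and> d < c \<and> c < a) \<and>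
      \<not> (c < b \<and> b < d \<and> d < a) \<and> \<not> (c < b \<and> b < a \<and> a < d)"
    proof (cases "subseq [a, b, c, d] (map (bump v) ?\<rho>)")
      case True
      show ?thesis using evil_avoidingD[OF em True] by (intro conjI)
    next
      case False
      then have a: "a = v" and "subseq [b, c, d] (map (bump v) ?\<rho>)"
        using s subseq_Cons_Cons_iff by metis+
      then obtain zs where "[b, c, d] = map (bump v) zs" "subseq zs ?\<rho>"
        unfolding subseq_map_conv by metis
      then obtain w x z where bcd: "b = bump v w" "c = bump v x" "d = bump v z"
        and wxz: "subseq [w, x, z] ?\<rho>"
        by (auto simp: Cons_eq_map_conv)
      have lt: "bump v p < bump v q \<longleftrightarrow> p < q" "bump v p < v \<longleftrightarrow> p < v" "v < bump v p \<longleftrightarrow> v \<le> p" for p q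
        by (auto simp: bump_def)
      have wx: "subseq [w, x] ?\<rho>"
        using wxz subseq_order.order_trans[of "[w, x]" "[w, x, z]"] by simp
      have xz: "subseq [x, z] ?\<rho>" by (rule subseq_Cons'[OF wxz])
      have "\<not> (x < v \<and> v \<le> z \<and> z < w)"
      proof
        assume o: "x < v \<and> v \<le> z \<and> z < w"
        then have xP: "x \<notin> set P" using v(2) by (metis not_le)
        then have "subseq [x, z] (1 # Q)" by (rule tail[OF xz])
        then have "subseq [z] Q" using subseq_Cons_Cons_iff[of x "[z]" 1 Q] subseq_Cons' by metis
        then have zQ: "z \<in> set Q" by (simp add: subseq_singleton_left)
        have "z \<noteq> v" using zQ v(1) dist by auto
        then have vz: "v < z" using o by simp
        \<comment> \<open>For \<open>w\<close> in \<open>P\<close>, the entry \<open>z\<close> to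
          the right of 1 would lie in value between two entries of \<open>P\<close>. So
          \<open>w\<close>, \<open>x\<close>, \<open>z\<close> all lie beyond \<open>P\<close>, and
          the old \<open>v\<close> before them completes 2413.\<close>
        have "w \<notin> set P" using S1[OF v(1) _ zQ, of w] vz o by blast
        then have "subseq [w, x, z] (1 # Q)" by (rule tail[OF wxz])
        then have "subseq ([v] @ [w, x, z]) ?\<rho>"
          using v(1) by (intro list_emb_append_mono) (simp_all add: subseq_singleton_left)
        then show False using evil_avoidingD(1)[OF e, of v w x z] o vz by simp
      qed
      \<comment> \<open>The other three patterns, started by the new \<open>v\<close>, contain a
        descent among entries below \<open>v\<close>, which \<open>low\<close> excludes.\<close>
      then show ?thesis
        using low[OF wx] low[OF xz] unfolding a bcd lt by linarith
    qed
  qed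
qed

section \<open>The recurrence for gapped evil-avoiding permutations\<close>

text \<open>The value to be restored in front by the map \<open>?f\<close> of
  \<open>cnt_evil_gapped\<close>; it is meaningful when some entry precedes 1.\<close>

definition prefix_min :: "nat list \<Rightarrow> nat" where
  "prefix_min \<rho> = Min (set (takeWhile (\<lambda>x. x \<noteq> 1) \<rho>))"

lemma prefix_min_eq:
  assumes "1 \<notin> set P" "v \<in> set P" "\<forall>x \<in> set P. v \<le> x"
  shows "prefix_min (P @ 1 # Q) = v"
proof -
  have "takeWhile (\<lambda>x. x \<noteq> 1) (P @ 1 # Q) = P"
    using assms(1) by (subst takeWhile_append2) auto
  then show ?thesis unfolding prefix_min_def using assms by (simp add: Min_eqI)
qed

text \<open>\<open>?I\<close> has a run of length at least two before 1 and is shortened by its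
  first entry. \<open>?J\<close> and \<open>?K\<close> have a single entry there; deleting it
  together with 1 removes one recoil in \<open>?J\<close> and none in \<open>?K\<close>.\<close>

lemma cnt_evil_gapped:
  "cnt (\<lambda>\<pi>. evil_avoiding \<pi> \<and> gapped \<pi>) (Suc (Suc (Suc n))) k =
     cnt (\<lambda>\<pi>. evil_avoiding \<pi> \<and> gapped \<pi>) (Suc (Suc n)) k
     + ((if k < 1 then 0 else cnt evil_avoiding (Suc n) (k - 1))
     + cnt (\<lambda>\<pi>. evil_avoiding \<pi> \<and> late_one \<pi>) (Suc n) k)"
proof -
  let ?E = "\<lambda>\<pi>. evil_avoiding \<pi> \<and> late_one \<pi>"
  let ?B = "\<lambda>\<pi>. evil_avoiding \<pi> \<and> gapped \<pi>"
  let ?I = "\<lambda>\<pi>. ?B \<pi> \<and> (\<exists>x zs. \<pi> = x # Suc x # zs)"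
  let ?J = "\<lambda>\<pi>. evil_avoiding \<pi> \<and> (\<exists>Q. \<pi> = 2 # 1 # Q)"
  let ?K = "\<lambda>\<pi>. evil_avoiding \<pi> \<and> (\<exists>s h Q. \<pi> = s # 1 # h # Q \<and> s \<noteq> 2 \<and> h \<noteq> 2)"
  let ?n = "Suc (Suc (Suc n))"
  \<comment> \<open>Inverse of the deletion in \<open>?K\<close>: the least entry \<open>v\<close>
    of \<rho> before 1 is inserted in front, then all values are raised and 1 is put second, which
    turns the new \<open>v\<close> into \<open>Suc v\<close>.\<close>
  let ?f = "\<lambda>\<rho>. Suc (prefix_min \<rho>) # 1 # map Suc (map (bump (prefix_min \<rho>)) \<rho>)"
  have "cnt ?B ?n k = cnt ?I ?n k + cnt (\<lambda>\<pi>. ?J \<pi> \<or> ?K \<pi>) ?n k"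
  proof (rule cnt_split)
    fix \<pi> assume \<pi>: "\<pi> \<in> Sn ?n"
    show "\<not> (?I \<pi> \<and> (?J \<pi> \<or> ?K \<pi>))"
      using \<pi> by (auto dest: Sn_Cons_bounds(1))
    have "?J \<pi> \<Longrightarrow> gapped \<pi>"
    proof -
      assume "?J \<pi>"
      then obtain Q where Q: "\<pi> = 2 # 1 # Q" by blast
      have "length \<pi> = ?n" using \<pi> distinct_card[of \<pi>] by (simp add: Sn_iff)
      then obtain h Q' where h: "Q = h # Q'" using Q by (cases Q) auto
      have "h \<noteq> 2" using \<pi> Q h by (auto simp: Sn_iff)
      moreover have "\<pi> = [2] @ 1 # h # Q'" using Q h by simp
      ultimately show "gapped \<pi>" unfolding gapped_def by blast
    qed
    moreover have "?K \<pi> \<Longrightarrow> gapped \<pi>"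
      unfolding gapped_def by (metis append_Cons append_Nil list.distinct(1))
    moreover have "?I \<pi> \<or> ?J \<pi> \<or> ?K \<pi>" if B: "?B \<pi>"
    proof -
      obtain P h Q where P: "P \<noteq> []" "h \<noteq> 2" "\<pi> = P @ 1 # h # Q"
        using B unfolding gapped_def by blast
      have e: "evil_avoiding (P @ 1 # h # Q)" using B P(3) by simp
      note pre = evil_gapped_prefix[OF \<pi>[unfolded P(3)] e P(2)]
      show ?thesis
      proof (cases "tl P")
        case Nil
        then obtain s where "P = [s]" using P(1) by (cases P) auto
        then show ?thesis using P B by auto
      next
        case (Cons y P')
        then obtain x where xy: "P = x # y # P'" using P(1) by (cases P) auto
        \<comment> \<open>Otherwise \<open>Suc x\<close> would have to occur, but it can stand
          neither after 1, where no value lies between two entries of \<open>P\<close>, nor later in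
          \<open>P\<close>, which is increasing.\<close>
        have "y = Suc x"
        proof (rule ccontr)
          assume ne: "y \<noteq> Suc x"
          have "subseq [x, y] P" using xy by simp
          then have "x < y" by (rule pre(2))
          then have z: "x < Suc x" "Suc x < y" using ne by auto
          have S: "set \<pi> = {1..?n}" using \<pi> by (simp only: Sn_iff)
          have "y \<in> {1..?n}" unfolding S[symmetric] using xy P(3) by simp
          then have "Suc x \<in> set \<pi>" unfolding S using z by simp
          moreover have "Suc x \<notin> set (h # Q)" using pre(3)[of x y "Suc x"] xy z by auto
          moreover have "Suc x \<notin> set P'"
          proof
            assume "Suc x \<in> set P'"
            then have "subseq [y, Suc x] P" using xy by (simp add: subseq_singleton_left)
            then show False using pre(2) z by fastforce
          qed
          moreover have "1 \<le> x" using Sn_Cons_bounds(1) \<pi> P(3) xy by auto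
          ultimately show False using P(3) xy z by auto
        qed
        then show ?thesis using B P(3) xy by auto
      qed
    qed
    ultimately show "?B \<pi> \<longleftrightarrow> ?I \<pi> \<or> (?J \<pi> \<or> ?K \<pi>)" by blast
  qed
  also have "cnt (\<lambda>\<pi>. ?J \<pi> \<or> ?K \<pi>) ?n k = cnt ?J ?n k + cnt ?K ?n k"
    by (rule cnt_split) auto
  also have "cnt ?I ?n k = cnt ?B (Suc (Suc n)) k"
  proof (rule cnt_bump_up)
    fix \<tau> assume \<tau>: "\<tau> \<in> Sn (Suc (Suc n))"
    then obtain a \<tau>' where a: "\<tau> = a # \<tau>'" by (metis Sn_Suc_Cons)
    have iff: "?B (hd \<tau> # map (bump (hd \<tau>)) \<tau>) \<longleftrightarrow> ?B \<tau>"
      unfolding a list.sel evil_bump_up[OF \<tau>[unfolded a]] gapped_bump_up[OF \<tau>[unfolded a]]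
      by (rule refl)
    have "bump a a = Suc a" by (simp add: bump_def)
    then show "?I (hd \<tau> # map (bump (hd \<tau>)) \<tau>)" if "?B \<tau>"
      using that iff a by auto
    show "?B \<tau>" if "?I (hd \<tau> # map (bump (hd \<tau>)) \<tau>)"
      using that iff by blast
  qed auto
  also have "cnt ?J ?n k = (if k < 1 then 0 else cnt evil_avoiding (Suc n) (k - 1))"
  proof (rule cnt_transfer[where f = "\<lambda>\<tau>. 2 # 1 # map Suc (map Suc \<tau>)"])
    show "inj_on (\<lambda>\<tau>. 2 # 1 # map Suc (map Suc \<tau>)) {\<tau> \<in> Sn (Suc n). evil_avoiding \<tau>}"
    proof (rule inj_onI)
      fix \<sigma> \<tau> :: "nat list"
      assume "2 # 1 # map Suc (map Suc \<sigma>) = 2 # 1 # map Suc (map Suc \<tau>)"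
      then have "map Suc (map Suc \<sigma>) = map Suc (map Suc \<tau>)" by (simp only: list.inject)
      then show "\<sigma> = \<tau>" by (simp only: inj_map_eq_map[OF inj_Suc])
    qed
  next
    fix \<tau> assume \<tau>: "\<tau> \<in> Sn (Suc n)" "evil_avoiding \<tau>"
    have eq: "map Suc (1 # map Suc \<tau>) = [2] @ map Suc (map Suc \<tau>)" by simp
    have \<tau>1: "1 # map Suc \<tau> \<in> Sn (Suc (Suc n))"
      using insert_one_perm[of \<tau> "[]" "map Suc \<tau>" "Suc n"] \<tau>(1) by simp
    note gt = map_Suc_gt_one[OF \<tau>1 eq]
    have "evil_avoiding (map Suc (1 # map Suc \<tau>))"
      using \<tau> evil_one_Cons evil_avoiding_map[OF strict_mono_Suc] by blast
    then have "evil_avoiding (2 # map Suc (map Suc \<tau>))" unfolding eq by simp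
    moreover have "\<not> (y < x \<and> x < 2)" if "subseq [x, y] (map Suc (map Suc \<tau>))" for x y
    proof -
      have "y \<in> set (map Suc (map Suc \<tau>))" using subseq_set[OF that] by simp
      then have "1 < y" using gt by blast
      then show ?thesis by simp
    qed
    ultimately have "evil_avoiding (2 # 1 # map Suc (map Suc \<tau>))"
      using evil_singleton_one[OF gt] by blast
    moreover have "2 # 1 # map Suc (map Suc \<tau>) \<in> Sn ?n"
      using insert_one_perm[OF eq, of "Suc (Suc n)"] \<tau>1 by simp
    ultimately show "2 # 1 # map Suc (map Suc \<tau>) \<in> Sn ?n \<and> ?J (2 # 1 # map Suc (map Suc \<tau>))"
      by blast
    show "card (recoils (2 # 1 # map Suc (map Suc \<tau>))) = card (recoils \<tau>) + 1"
      using insert_one_recoils[OF \<tau>1 eq] insert_one_recoils[OF \<tau>(1), of "[]" "map Suc \<tau>"] by simp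
  next
    fix \<pi> assume \<pi>: "\<pi> \<in> Sn ?n" "?J \<pi>"
    then obtain Q where Q: "\<pi> = [2] @ 1 # Q" by auto
    then obtain \<tau>1 where \<tau>1: "\<tau>1 \<in> Sn (Suc (Suc n))" "map Suc \<tau>1 = [2] @ Q"
      using \<pi>(1) delete_one_perm by metis
    then obtain \<tau>2 where \<tau>2: "\<tau>1 = [] @ 1 # \<tau>2" "Q = map Suc \<tau>2"
      by (auto simp: map_eq_Cons_conv)
    then obtain \<tau> where \<tau>: "\<tau> \<in> Sn (Suc n)" "map Suc \<tau> = [] @ \<tau>2"
      using \<tau>1(1) delete_one_perm by metis
    have eq: "\<pi> = 2 # 1 # map Suc (map Suc \<tau>)" using Q \<tau>2(2) \<tau>(2) by simp
    have "subseq (map Suc (map Suc \<tau>)) \<pi>" unfolding eq by (intro list_emb_Cons) simp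
    then have "evil_avoiding \<tau>"
      using \<pi>(2) evil_avoiding_subseq evil_avoiding_map[OF strict_mono_Suc] by blast
    then show "\<exists>\<tau> \<in> Sn (Suc n). evil_avoiding \<tau> \<and> \<pi> = 2 # 1 # map Suc (map Suc \<tau>)"
      using \<tau>(1) eq by blast
  qed
  also have "cnt ?K ?n k = (if k < 0 then 0 else cnt ?E (Suc n) (k - 0))"
  proof (rule cnt_transfer[where f = ?f])
    show "inj_on ?f {\<tau> \<in> Sn (Suc n). ?E \<tau>}"
    proof (rule inj_onI)
      fix \<sigma> \<tau> :: "nat list"
      assume "?f \<sigma> = ?f \<tau>"
      then have "prefix_min \<sigma> = prefix_min \<tau> \<and>
          map Suc (map (bump (prefix_min \<sigma>)) \<sigma>) = map Suc (map (bump (prefix_min \<tau>)) \<tau>)"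
        unfolding list.inject nat.inject by (elim conjE) (intro conjI)
      then show "\<sigma> = \<tau>" by (metis inj_map_eq_map inj_Suc inj_bump)
    qed
  next
    fix \<rho> assume \<rho>: "\<rho> \<in> Sn (Suc n)" "?E \<rho>"
    then obtain P Q where PQ: "\<rho> = P @ 1 # Q" "1 \<notin> set P" "P \<noteq> []" by (metis Sn_split_one)
    define v where "v = Min (set P)"
    have v: "v \<in> set P" "\<forall>x \<in> set P. v \<le> x" unfolding v_def using PQ(3) by auto
    have pm: "prefix_min \<rho> = v" unfolding PQ(1) by (rule prefix_min_eq[OF PQ(2) v])
    have e: "evil_avoiding (P @ 1 # Q)" using \<rho>(2) PQ(1) by simp
    note bm = evil_bump_min[OF \<rho>(1)[unfolded PQ(1)] e v, folded PQ(1)]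
    have S: "set \<rho> = {1..Suc n}" using \<rho>(1) by (simp only: Sn_iff)
    have v1: "1 < v" using Sn_split_one_gt[OF \<rho>(1)[unfolded PQ(1)]] v(1) by simp
    have "v \<in> {1..Suc n}" unfolding S[symmetric] using v(1) PQ(1) by simp
    then have vb: "1 \<le> v" "v \<le> Suc (Suc n)" by auto
    have vm: "v # map (bump v) \<rho> \<in> Sn (Suc (Suc n))" using bump_perm[OF vb] \<rho>(1) by blast
    have eq: "map Suc (v # map (bump v) \<rho>) = [Suc v] @ map Suc (map (bump v) \<rho>)" by simp
    note gt = map_Suc_gt_one[OF vm eq]
    have "evil_avoiding (map Suc (v # map (bump v) \<rho>))"
      using bm(2) evil_avoiding_map[OF strict_mono_Suc] by blast
    then have "evil_avoiding (Suc v # map Suc (map (bump v) \<rho>))" by simp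
    \<comment> \<open>Such a descent would come from a descent of \<rho> below \<open>v\<close>,
      which the first part of \<open>evil_bump_min\<close> excludes.\<close>
    moreover have "\<not> (y < x \<and> x < Suc v)" if xy: "subseq [x, y] (map Suc (map (bump v) \<rho>))" for x y
    proof -
      have "subseq [x, y] (map (\<lambda>x. Suc (bump v x)) \<rho>)" using xy by (simp add: comp_def)
      then obtain zs where "[x, y] = map (\<lambda>x. Suc (bump v x)) zs" "subseq zs \<rho>"
        unfolding subseq_map_conv by metis
      then obtain x' y' where "x = Suc (bump v x')" "y = Suc (bump v y')" "subseq [x', y'] \<rho>"
        by (auto simp: Cons_eq_map_conv)
      then show ?thesis using bm(1)[of x' y'] by (auto simp: bump_def split: if_splits)
    qed
    ultimately have ev: "evil_avoiding (?f \<rho>)"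
      unfolding pm using evil_singleton_one[OF gt] by blast
    have in_Sn: "?f \<rho> \<in> Sn ?n"
      unfolding pm using insert_one_perm[OF eq, of "Suc (Suc n)"] vm by simp
    obtain p P' where P': "P = p # P'" using PQ(3) by (cases P) auto
    have "v \<le> p" using v(2) P' by simp
    then have "bump v p = Suc p" by (simp add: bump_def)
    then have f\<rho>: "?f \<rho> = Suc v # 1 # Suc (Suc p) # map Suc (map (bump v) (P' @ 1 # Q))"
      unfolding pm using PQ(1) P' by simp
    have ne: "Suc v \<noteq> 2" "Suc (Suc p) \<noteq> 2" using v1 \<open>v \<le> p\<close> by simp_all
    show "?f \<rho> \<in> Sn ?n \<and> ?K (?f \<rho>)"
      by (intro conjI in_Sn ev exI, rule f\<rho>, rule ne, rule ne)
    \<comment> \<open>Minimality of \<open>v\<close> puts \<open>v - 1\<close> to the right of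
      \<open>P\<close>. So \<rho> already has the recoil \<open>v - 1\<close>, and a new first entry
      \<open>v\<close> gains none.\<close>
    have "subseq [v, v - 1] \<rho>"
    proof -
      have "v - 1 \<in> set \<rho>" unfolding S using v1 vb \<open>v \<in> {1..Suc n}\<close> by auto
      moreover have "v - 1 \<notin> set P" using v(2) v1 by force
      ultimately have "v - 1 \<in> set (1 # Q)" using PQ(1) by auto
      then have "subseq ([v] @ [v - 1]) (P @ 1 # Q)"
        using v(1) by (intro list_emb_append_mono) (simp_all only: subseq_singleton_left)
      then show ?thesis using PQ(1) by simp
    qed
    then have "card (recoils (v # map (bump v) \<rho>)) = card (recoils \<rho>)"
      by (intro bump_recoils_same[OF \<rho>(1) vb])
    then show "card (recoils (?f \<rho>)) = card (recoils \<rho>) + 0"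
      unfolding pm using insert_one_recoils[OF vm eq] v1 by simp
  next
    fix \<pi> assume \<pi>: "\<pi> \<in> Sn ?n" "?K \<pi>"
    then obtain s h R where R: "\<pi> = [s] @ 1 # (h # R)" "s \<noteq> 2" "h \<noteq> 2" by auto
    then obtain \<tau> where \<tau>: "\<tau> \<in> Sn (Suc (Suc n))" "map Suc \<tau> = [s] @ (h # R)"
      using \<pi>(1) delete_one_perm by metis
    then obtain v \<tau>' where v: "\<tau> = v # \<tau>'" "s = Suc v" "h # R = map Suc \<tau>'" by (auto simp: map_eq_Cons_conv)
    obtain \<rho> where \<rho>: "\<rho> \<in> Sn (Suc n)" "\<tau>' = map (bump v) \<rho>"
      using unbump_perm \<tau>(1) v(1) by blast
    have v2: "2 \<le> v" using Sn_Cons_bounds(1)[OF \<tau>(1)[unfolded v(1)]] v(2) R(2) by simp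
    have p: "\<pi> = Suc v # 1 # map Suc (map (bump v) \<rho>)" using R(1) v(2,3) \<rho>(2) by simp
    have "subseq (map Suc (map (bump v) \<rho>)) \<pi>" unfolding p by (intro list_emb_Cons) simp
    then have "evil_avoiding \<rho>"
      using \<pi>(2) evil_avoiding_subseq evil_avoiding_map[OF strict_mono_Suc]
        evil_avoiding_map[OF strict_mono_bump] by blast
    obtain P Q where PQ: "\<rho> = P @ 1 # Q" "1 \<notin> set P" "late_one \<rho> \<longleftrightarrow> P \<noteq> []"
      using \<rho>(1) by (rule Sn_split_one)
    have b1: "bump v 1 = 1" using v2 by (simp add: bump_def)
    \<comment> \<open>If \<rho> started with 1, the entry \<open>h\<close> of \<pi> would be
      2.\<close>
    have "P \<noteq> []"
    proof
      assume "P = []"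
      then have "h = Suc (bump v 1)" using v(3) \<rho>(2) PQ(1) by simp
      then show False using b1 R(3) by simp
    qed
    have p1: "\<pi> = [Suc v] @ 1 # map Suc (map (bump v) \<rho>)" using p by simp
    have e1: "evil_avoiding ([Suc v] @ 1 # map Suc (map (bump v) \<rho>))" using \<pi>(2) p1 by simp
    note gt1 = Sn_split_one_gt[OF \<pi>(1)[unfolded p1]]
    note S3 = evil_insert_minD(4)[OF e1 gt1]
    \<comment> \<open>A smaller \<open>x\<close> in \<open>P\<close> would give 4132 in \<pi>,
      namely \<open>Suc v\<close>, 1, \<open>Suc x\<close>, 2.\<close>
    have low: "v \<le> x" if "x \<in> set P" for x
    proof (rule ccontr)
      assume "\<not> v \<le> x"
      then have xv: "x < v" by simp
      have "subseq ([x] @ [1]) (P @ 1 # Q)"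
        using that by (intro list_emb_append_mono) (simp_all add: subseq_singleton_left)
      then have "subseq (map Suc (map (bump v) [x, 1])) (map Suc (map (bump v) \<rho>))"
        unfolding PQ(1) by (intro subseq_map) simp
      then have "subseq [Suc x, 2] (map Suc (map (bump v) \<rho>))"
        using xv v2 by (simp add: bump_def numeral_2_eq_2)
      then have "\<not> (2 < Suc x \<and> Suc x < Suc v)" by (rule S3) simp
      moreover have "1 < x" using Sn_split_one_gt[OF \<rho>(1)[unfolded PQ(1)]] that by simp
      ultimately show False using xv by simp
    qed
    \<comment> \<open>If \<open>v\<close> came after 1 in \<rho>, its image \<open>Suc v\<close> in
      \<tau> would lie in value between the first entry \<open>v\<close> and
      \<open>bump v p\<close>, giving 2413. Together with \<open>low\<close> this makes
      \<open>v\<close> the prefix minimum.\<close>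
    have "v \<in> set P"
    proof (rule ccontr)
      assume vP: "v \<notin> set P"
      obtain p where pP: "p \<in> set P" using \<open>P \<noteq> []\<close> by (cases P) auto
      have vp: "v < p" using low[OF pP] vP pP by (metis le_neq_implies_less)
      have S: "set \<rho> = {1..Suc n}" using \<rho>(1) by (simp only: Sn_iff)
      have "p \<in> set \<rho>" using pP PQ(1) by simp
      then have "v \<in> set \<rho>" unfolding S using vp v2 by simp
      then have "v \<in> set Q" using PQ(1) vP v2 by auto
      have \<tau>eq: "\<tau> = (v # map (bump v) P) @ 1 # map (bump v) Q"
        using v(1) \<rho>(2) PQ(1) b1 by simp
      have "evil_avoiding (map Suc \<tau>)"
        using evil_insert_minD(1)[OF e1 gt1] v(1) \<rho>(2) by simp
      then have "evil_avoiding \<tau>" using evil_avoiding_map[OF strict_mono_Suc] by blast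
      then have e2: "evil_avoiding ((v # map (bump v) P) @ 1 # map (bump v) Q)" using \<tau>eq by simp
      note gt2 = Sn_split_one_gt[OF \<tau>(1)[unfolded \<tau>eq]]
      have "\<not> (v < bump v v \<and> bump v v < bump v p)"
        using \<open>v \<in> set Q\<close> pP by (intro evil_insert_minD(2)[OF e2 gt2]) auto
      then show False using vp by (simp add: bump_def)
    qed
    then have "prefix_min \<rho> = v" unfolding PQ(1) using low by (intro prefix_min_eq PQ(2)) auto
    then have "\<pi> = ?f \<rho>" using p by simp
    then show "\<exists>\<rho> \<in> Sn (Suc n). ?E \<rho> \<and> \<pi> = ?f \<rho>"
      using \<rho>(1) \<open>evil_avoiding \<rho>\<close> PQ(3) \<open>P \<noteq> []\<close> by blast
  qed
  finally show ?thesis by simp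
qed

section \<open>Comparing the two classes\<close>

lemma cnt_late_one_1: "cnt (\<lambda>\<pi>. P \<pi> \<and> late_one \<pi>) (Suc 0) k = 0"
proof (rule cnt_eq_0)
  fix \<pi> assume "\<pi> \<in> Sn (Suc 0)"
  then obtain a \<tau> where "\<pi> = a # \<tau>" "1 \<le> a" "a \<le> Suc 0" by (rule Sn_Suc_Cons)
  then show "\<not> (P \<pi> \<and> late_one \<pi>)" by (simp add: late_one_def)
qed

text \<open>Here b(n+2,k) = e(n+1,k): for \<open>n = 0\<close> both vanish, and otherwise the
  right-hand sides of \<open>cnt_evil_gapped\<close> and of \<open>cnt_evil_late_split\<close> one
  size lower agree up to order.\<close>

lemma cnt_evil_late:
  "cnt (\<lambda>\<pi>. evil_avoiding \<pi> \<and> late_one \<pi>) (Suc (Suc n)) k =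
     (if k < 1 then 0 else cnt evil_avoiding (Suc n) (k - 1))
      + 2 * cnt (\<lambda>\<pi>. evil_avoiding \<pi> \<and> late_one \<pi>) (Suc n) k"
proof -
  have "cnt (\<lambda>\<pi>. evil_avoiding \<pi> \<and> gapped \<pi>) (Suc (Suc n)) k =
      cnt (\<lambda>\<pi>. evil_avoiding \<pi> \<and> late_one \<pi>) (Suc n) k"
  proof (cases n)
    case 0
    have "cnt (\<lambda>\<pi>. evil_avoiding \<pi> \<and> gapped \<pi>) (Suc (Suc 0)) k = 0"
    proof (rule cnt_eq_0)
      fix \<pi> assume "\<pi> \<in> Sn (Suc (Suc 0))"
      then have "length \<pi> = 2" using distinct_card[of \<pi>] by (simp add: Sn_iff)
      then show "\<not> (evil_avoiding \<pi> \<and> gapped \<pi>)" by (auto simp: gapped_def)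
    qed
    then show ?thesis using 0 cnt_late_one_1 by simp
  next
    case (Suc m)
    show ?thesis unfolding Suc cnt_evil_gapped cnt_evil_late_split[of m] by simp
  qed
  then show ?thesis using cnt_evil_late_split[of n k] by simp
qed

text \<open>Both classes obey the same recurrences, and their late counts vanish in size one. Since
  one recurrence lowers \<open>k\<close>, the induction keeps \<open>k\<close> arbitrary.\<close>

lemma cnt_evil_eq_cnt_rectangular:
  "cnt evil_avoiding n k = cnt rectangular n k \<and>
   cnt (\<lambda>\<pi>. evil_avoiding \<pi> \<and> late_one \<pi>) n k = cnt (\<lambda>\<pi>. rectangular \<pi> \<and> late_one \<pi>) n k"
proof (induction n arbitrary: k)
  case 0
  have "\<pi> = []" if "\<pi> \<in> Sn 0" for \<pi> using that by (simp add: Sn_iff)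
  moreover have "evil_avoiding []" "rectangular []"
    by (simp_all add: evil_avoiding_iff rectangular_iff)
  ultimately have "evil_avoiding \<pi> \<longleftrightarrow> rectangular \<pi>" if "\<pi> \<in> Sn 0" for \<pi>
    using that by blast
  then show ?case unfolding cnt_def by (simp cong: conj_cong)
next
  case (Suc n)
  have "cnt (\<lambda>\<pi>. evil_avoiding \<pi> \<and> late_one \<pi>) (Suc n) k =
      cnt (\<lambda>\<pi>. rectangular \<pi> \<and> late_one \<pi>) (Suc n) k"
  proof (cases n)
    case 0
    then show ?thesis by (simp only: cnt_late_one_1)
  next
    case (Suc m)
    show ?thesis unfolding Suc cnt_evil_late cnt_rectangular_late using Suc.IH[unfolded Suc] by simp
  qed
  then show ?case
    using cnt_Suc[of n evil_avoiding k, OF evil_one_Cons]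
      cnt_Suc[of n rectangular k, OF rectangular_one_Cons] Suc.IH by simp
qed

theorem theorem1p10:
  fixes n k :: nat
  assumes "n \<ge> 1"
  shows "\<exists>f. bij_betw f
           {\<pi> \<in> permutations_of_set {1..n}. evil_avoiding \<pi> \<and> card (recoils \<pi>) = k}
           {\<pi> \<in> permutations_of_set {1..n}. rectangular \<pi> \<and> card (recoils \<pi>) = k}"
  \<comment> \<open>The bijection comes from equal cardinalities of finite sets; no explicit map is
    built.\<close>
  using cnt_evil_eq_cnt_rectangular[of n k] unfolding cnt_def Sn_def
  by (intro finite_same_card_bij) auto

end
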